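(* Let $k\ge 0$ be an integer and let $T$ be a caterpillar with spine vertices $v_0,v_1,\ldots,v_k,v_{k+1}$ in order. Then $a_u(T)=1$ if and only if for every $s$ with $1\le s\le k$, every set $S$ of $s$ consecutive internal vertices on the spine (that is, $S=\{v_i,v_{i+1},\ldots,v_{i+s-1}\}$ with $1\le i$ and $i+s-1\le k$) satisfies $$\sum_{v\in S} d'(v)\ \ge\ \ell(s)=\left\lceil \frac{s+1}{2}\right\rceil\left\lfloor \frac{s+1}{2}\right\rfloor .$$
   Context: Graphs are finite, simple and undirected. The vertices of a graph carry nonnegative integer weights. A unit acquisition move transfers one unit of weight from a vertex $u$ of positive weight to a neighbor $v$ of $u$, under the condition that before the move the weight of $v$ is at least the weight of $u$. The unit acquisition number $a_u(G)$ of a graph $G$ is the minimum size to which the set of vertices with positive weight can be reduced via successive unit acquisition moves, starting from the configuration in which every vertex has weight $1$. A caterpillar is a tree in which all non-leaf vertices lie on one path. The path obtained by deleting all the leaves of a caterpillar is its spine; its vertices are denoted $v_0,\ldots,v_{k+1}$, indexed in order along the path (so $v_0$ and $v_{k+1}$ are not leaves of $T$). The vertices $v_1,\ldots,v_k$ are the internal vertices of the spine. For $v\in V(T)$, $d'(v)$ denotes the number of leaves of $T$ adjacent to $v$. For a positive integer $s$, $\ell(s)=\sum_{i=1}^s\lceil i/2\rceil=\left\lceil\frac{s+1}{2}\right\rceil\left\lfloor\frac{s+1}{2}\right\rfloor$. *)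

theory Defs
  imports Complex_Main "Graph_Theory.Graph_Theory"
begin

text \<open>
  A finite simple undirected graph is a symmetric digraph satisfying the locale \<^locale>\<open>graph\<close>;
  each undirected edge is a pair of opposite arcs. In this encoding the library's
  \<^const>\<open>tree\<close> is not the undirected notion: traversing an edge back and forth is a
  \<^const>\<open>pre_digraph.cycle\<close> of length 2. An undirected cycle is a cycle of length at least 3.
\<close>

definition undirected_tree :: "('a, 'b) pre_digraph \<Rightarrow> bool" where
  "undirected_tree G \<longleftrightarrow> graph G \<and> Digraph_Component.connected G \<and>
     \<not> (\<exists>p. pre_digraph.cycle G p \<and> 3 \<le> length p)"

definition is_leaf :: "('a, 'b) pre_digraph \<Rightarrow> 'a \<Rightarrow> bool" where
  "is_leaf G v \<longleftrightarrow> v \<in> verts G \<and> out_degree G v = 1"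

definition non_leaves :: "('a, 'b) pre_digraph \<Rightarrow> 'a set" where
  "non_leaves G = {v \<in> verts G. \<not> is_leaf G v}"

text \<open>The number \<open>d'(v)\<close> of leaves adjacent to \<open>v\<close>.\<close>

definition leaf_degree :: "('a, 'b) pre_digraph \<Rightarrow> 'a \<Rightarrow> nat" where
  "leaf_degree G v = card {u. v \<rightarrow>\<^bsub>G\<^esub> u \<and> is_leaf G u}"

definition caterpillar :: "('a, 'b) pre_digraph \<Rightarrow> bool" where
  "caterpillar G \<longleftrightarrow> undirected_tree G \<and> (\<exists>p. vpath p G \<and> non_leaves G \<subseteq> set p)"

text \<open>\<open>H\<close> is, as a graph, a path whose vertices in order are \<open>p\<close>.\<close>

definition path_graph :: "('a, 'b) pre_digraph \<Rightarrow> 'a list \<Rightarrow> bool" where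
  "path_graph H p \<longleftrightarrow> p \<noteq> [] \<and> distinct p \<and> verts H = set p \<and>
     (\<forall>u v. u \<rightarrow>\<^bsub>H\<^esub> v \<longleftrightarrow> (\<exists>i. Suc i < length p \<and> {u, v} = {p ! i, p ! Suc i}))"

definition spine :: "('a, 'b) pre_digraph \<Rightarrow> 'a list \<Rightarrow> bool" where
  "spine G p \<longleftrightarrow> path_graph (G \<restriction> non_leaves G) p"

definition unit_acquisition_move ::
    "('a, 'b) pre_digraph \<Rightarrow> ('a \<Rightarrow> nat) \<Rightarrow> ('a \<Rightarrow> nat) \<Rightarrow> bool" where
  "unit_acquisition_move G w w' \<longleftrightarrow>
     (\<exists>u v. u \<rightarrow>\<^bsub>G\<^esub> v \<and> 0 < w u \<and> w u \<le> w v \<and> w' = w(u := w u - 1, v := w v + 1))"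

text \<open>
  Weights are total functions; their values outside \<open>verts G\<close> are never changed by moves and never
  counted.
\<close>

definition unit_acquisition_number :: "('a, 'b) pre_digraph \<Rightarrow> nat" where
  "unit_acquisition_number G =
     (LEAST n. \<exists>w. (unit_acquisition_move G)\<^sup>*\<^sup>* (\<lambda>_. 1) w \<and> n = card {v \<in> verts G. 0 < w v})"

definition ell :: "nat \<Rightarrow> nat" where
  "ell s = (\<Sum>i = 1..s. nat \<lceil>real i / 2\<rceil>)"

lemma ell_closed_form: "ell s = nat (\<lceil>(real s + 1) / 2\<rceil> * \<lfloor>(real s + 1) / 2\<rfloor>)"
proof -
  have c: "nat \<lceil>real i / 2\<rceil> = (i + 1) div 2" for i :: nat
    by (cases "even i") (auto elim!: evenE oddE intro!: ceiling_unique arg_cong[where f = nat]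
        simp: nat_eq_iff ceiling_eq_iff)
  have f: "\<lfloor>real i / 2\<rfloor> = int (i div 2)" for i :: nat
    using floor_divide_of_nat_eq[of i 2] by simp
  have d: "\<lceil>(real s + 1) / 2\<rceil> = int ((s + 2) div 2)"
    using c[of "s + 1"] by (simp add: nat_eq_iff add.commute)
  have e: "\<lfloor>(real s + 1) / 2\<rfloor> = int ((s + 1) div 2)"
    using f[of "s + 1"] by (simp add: add.commute)
  have "ell s = ((s + 2) div 2) * ((s + 1) div 2)"
  proof (induction s)
    case 0
    then show ?case by (simp add: ell_def)
  next
    case (Suc s)
    have "ell (Suc s) = ell s + (s + 2) div 2"
      by (simp add: ell_def c)
    then show ?case
      using Suc by (cases "even s") (auto elim!: evenE oddE simp: algebra_simps)
  qed
  then show ?thesis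
    unfolding d e by (metis nat_int of_nat_mult)
qed

end

theory Submission
  imports Defs
begin

text \<open>
  Let the spine positions be \<open>0, \<dots>, n\<close> with \<open>n = k + 1\<close>. The number \<open>ell s\<close> is the volume of a
  pyramid on a base of \<open>s\<close> positions, whose height at each position is the distance to the nearer end
  of the base, counted so that the ends have height one (\<open>sum_pyramid\<close>). A spine vertex of
  weight \<open>w\<close> is thought of as a column of \<open>w - 1\<close> filled cells.

  Sufficiency. The aim is to fill the pyramid over the internal spine vertices with units from the
  leaves. Since the weights have to rise along the way of a unit, the cell at height \<open>h\<close> over \<open>t\<close> is
  served from a position at distance less than \<open>h\<close>. The cells confined to a window of \<open>s\<close> positions by
  this restriction number exactly \<open>ell s\<close>, so the hypothesis is Hall's condition for assigning leaves
  to cells (\<open>serving_exists\<close>). Whether the assigned units can really be moved depends on the order. The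
  constraints on the order are acyclic for an assignment of least total distance, because a cycle
  would contain two cells that are served across each other (\<open>acyclic_precedence\<close>); and in any
  compatible order each unit finds a suitable slope on its way (\<open>fill_cell\<close>). On the completed pyramid
  the weights increase towards the middle, where all remaining weight can be gathered
  (\<open>peaked_drains\<close>).

  Necessity. Suppose that the leaves of some window are fewer than \<open>ell s\<close>. Then the pyramid over the
  window has more holes than leaves to fill them. A move along the spine never reduces the number of
  holes (\<open>holes_spine_move\<close>), in particular weight from outside does not help: to climb onto
  the pyramid it would have to pass from a heavier vertex to a lighter one. So there are always
  holes left between two heavy vertices or regions, one on each side, which never meet
  (\<open>blocked_move\<close>). The exceptions are moves that empty a vertex and thereby disconnect positive
  weight for good (\<open>stuck_move\<close>).
\<close>

section \<open>Pyramids and their volume\<close>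

text \<open>
  The height at position \<open>t\<close> of a pyramid standing on the positions \<open>{a..<b}\<close>, rising by one per
  step from both ends. Truncated subtraction makes it \<open>0\<close> outside the base, so that heights at
  neighbouring positions differ by at most one everywhere.
\<close>

definition pyramid :: "nat \<Rightarrow> nat \<Rightarrow> nat \<Rightarrow> nat" where
  "pyramid a b t = min (t + 1 - a) (b - t)"

lemma ell_0 [simp]: "ell 0 = 0"
  by (simp add: ell_def)

lemma ell_Suc: "ell (Suc s) = ell s + (s + 2) div 2"
proof -
  have "nat \<lceil>real (Suc s) / 2\<rceil> = (s + 2) div 2"
    by (cases "even s") (auto elim!: evenE oddE intro!: ceiling_unique arg_cong[where f = nat]
        simp: nat_eq_iff ceiling_eq_iff)
  then show ?thesis by (simp add: ell_def)
qed

text \<open>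
  Removing the bottom layer of a pyramid of base \<open>s + 2\<close> leaves a pyramid of base \<open>s\<close>; this gives a
  two-step recursion for the volume, which \<^const>\<open>ell\<close> satisfies as well.
\<close>

lemma sum_pyramid: "(\<Sum>t = a..<a + s. pyramid a (a + s) t) = ell s"
proof (induction s arbitrary: a rule: induct_nat_012)
  case (ge2 s)
  have "(\<Sum>t = a..<a + Suc (Suc s). pyramid a (a + Suc (Suc s)) t)
      = pyramid a (a + Suc (Suc s)) a + (\<Sum>t = Suc a..<Suc a + s. pyramid a (a + Suc (Suc s)) t)
        + pyramid a (a + Suc (Suc s)) (Suc (a + s))"
    by (simp add: sum.atLeast_Suc_lessThan)
  also have "(\<Sum>t = Suc a..<Suc a + s. pyramid a (a + Suc (Suc s)) t)
      = (\<Sum>t = Suc a..<Suc a + s. pyramid (Suc a) (Suc a + s) t + 1)"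
    by (rule sum.cong) (auto simp: pyramid_def)
  also have "\<dots> = ell s + s"
    using ge2.IH(1)[of "Suc a"] by (simp only: sum.distrib) simp
  finally show ?case
    by (simp add: pyramid_def ell_Suc)
qed (simp_all add: ell_Suc pyramid_def)

section \<open>Matching intervals to supplies\<close>

text \<open>
  Hall's theorem for jobs \<open>c\<close> that may be served anywhere in an interval \<open>{lo c..hi c}\<close>: for
  interval neighbourhoods the Hall condition has to be tested on intervals only. The matching is
  found greedily, earliest deadline first.
\<close>

lemma interval_matching:
  fixes lo hi :: "'c \<Rightarrow> nat" and d :: "nat \<Rightarrow> nat"
  assumes "finite C"
    and "\<And>l u. card {c \<in> C. l \<le> lo c \<and> hi c \<le> u} \<le> (\<Sum>x = l..u. d x)"
  shows "\<exists>M. (\<forall>c \<in> C. lo c \<le> M c \<and> M c \<le> hi c) \<and> (\<forall>x. card {c \<in> C. M c = x} \<le> d x)"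
  using assms
proof (induction "card C" arbitrary: C d)
  case 0
  then show ?case by (intro exI[of _ lo]) simp
next
  case (Suc m)
  note hall = Suc.prems(2)
  have fin: "finite C" by fact
  \<comment> \<open>the leftmost supply \<open>x0\<close> by which some job has started goes to a started job \<open>c\<close> of earliest deadline\<close>
  define P where "P x \<longleftrightarrow> 0 < d x \<and> (\<exists>c \<in> C. lo c \<le> x)" for x
  have served: "\<exists>x. lo c \<le> x \<and> x \<le> hi c \<and> P x" if "c \<in> C" for c
  proof -
    have "0 < card {c' \<in> C. lo c \<le> lo c' \<and> hi c' \<le> hi c}"
      using that fin by (auto simp: card_gt_0_iff)
    then have "0 < (\<Sum>x = lo c..hi c. d x)" using hall[of "lo c" "hi c"] by linarith
    then obtain x where "x \<in> {lo c..hi c}" "0 < d x"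
      by (metis gr0I sum.neutral less_irrefl)
    with that show ?thesis unfolding P_def by auto
  qed
  have "C \<noteq> {}" using Suc.hyps(2) by auto
  then have "\<exists>x. P x" using served by blast
  define x0 where "x0 = (LEAST x. P x)"
  have Px0: "P x0" using \<open>\<exists>x. P x\<close> unfolding x0_def by (rule LeastI_ex)
  have least: "x0 \<le> x" if "P x" for x using that unfolding x0_def by (rule Least_le)
  let ?J = "{c \<in> C. lo c \<le> x0}"
  have "?J \<noteq> {}" using Px0 unfolding P_def by auto
  then obtain c where c: "c \<in> ?J" and cmin: "\<And>c'. c' \<in> ?J \<Longrightarrow> hi c \<le> hi c'"
    using ex_has_least_nat[of "\<lambda>c. c \<in> ?J" _ hi] by blast
  have "x0 \<le> hi c" using served[of c] c least by fastforce
  let ?d = "d(x0 := d x0 - 1)"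
  have d0: "0 < d x0" using Px0 P_def by simp
  have sumd: "(\<Sum>x = l..u. d x) = (\<Sum>x = l..u. ?d x) + (if l \<le> x0 \<and> x0 \<le> u then 1 else 0)" for l u
  proof (cases "l \<le> x0 \<and> x0 \<le> u")
    case True
    then have "x0 \<in> {l..u}" by simp
    then show ?thesis using d0 True by (simp add: sum.remove[of "{l..u}" x0])
  next
    case False
    then show ?thesis by (auto intro!: sum.cong)
  qed
  have "\<exists>M. (\<forall>c' \<in> C - {c}. lo c' \<le> M c' \<and> M c' \<le> hi c') \<and> (\<forall>x. card {c' \<in> C - {c}. M c' = x} \<le> ?d x)"
  proof (rule Suc.hyps(1))
    show "m = card (C - {c})" using Suc.hyps(2) c fin by simp
    show "finite (C - {c})" using fin by simp
    fix l u
    let ?N = "\<lambda>C l u. {c' \<in> C. l \<le> lo c' \<and> hi c' \<le> u}"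
    have finN: "finite (?N C l u)" for l u using fin by simp
    show "card (?N (C - {c}) l u) \<le> (\<Sum>x = l..u. ?d x)"
    proof (cases "l \<le> x0 \<and> x0 \<le> u")
      case False
      have "card (?N (C - {c}) l u) \<le> card (?N C l u)"
        by (rule card_mono[OF finN]) auto
      then show ?thesis using hall[of l u] sumd[of l u] False by simp
    next
      case True
      show ?thesis
      proof (cases "hi c \<le> u")
        case hi: True
        \<comment> \<open>no usable supply lies in \<open>{lo c..<l}\<close>, so the condition on the wider interval, which counts \<open>c\<close> too, leaves room for one less\<close>
        let ?l = "min l (lo c)"
        have "insert c (?N (C - {c}) l u) \<subseteq> ?N C ?l u" using c hi by auto
        then have "card (insert c (?N (C - {c}) l u)) \<le> card (?N C ?l u)"
          by (rule card_mono[OF finN])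
        then have "Suc (card (?N (C - {c}) l u)) \<le> (\<Sum>x = ?l..u. d x)"
          using hall[of ?l u] fin by simp
        also have "(\<Sum>x = ?l..u. d x) = (\<Sum>x = l..u. d x)"
        proof (rule sum.mono_neutral_right)
          show "\<forall>x \<in> {?l..u} - {l..u}. d x = 0"
          proof
            fix x assume "x \<in> {?l..u} - {l..u}"
            then have "lo c \<le> x" "x < l" by auto
            then have "\<not> P x" using least[of x] True by auto
            then show "d x = 0" unfolding P_def using c \<open>lo c \<le> x\<close> by auto
          qed
        qed auto
        finally show ?thesis using sumd[of l u] True by simp
      next
        case False
        then have "?N (C - {c}) l u \<subseteq> ?N C (Suc x0) u" using cmin by force
        then have "card (?N (C - {c}) l u) \<le> card (?N C (Suc x0) u)"
          by (rule card_mono[OF finN])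
        also have "\<dots> \<le> (\<Sum>x = Suc x0..u. d x)" by (rule hall)
        also have "\<dots> = (\<Sum>x = Suc x0..u. ?d x)" by (rule sum.cong) auto
        also have "\<dots> \<le> (\<Sum>x = l..u. ?d x)" using True by (intro sum_mono2) auto
        finally show ?thesis .
      qed
    qed
  qed
  then obtain M where M: "\<forall>c' \<in> C - {c}. lo c' \<le> M c' \<and> M c' \<le> hi c'"
    and cap: "\<forall>x. card {c' \<in> C - {c}. M c' = x} \<le> ?d x" by blast
  have "card {c' \<in> C. (M(c := x0)) c' = x} \<le> d x" for x
  proof (cases "x = x0")
    case True
    then have "{c' \<in> C. (M(c := x0)) c' = x} = insert c {c' \<in> C - {c}. M c' = x}" using c by auto
    then have "card {c' \<in> C. (M(c := x0)) c' = x} \<le> Suc (card {c' \<in> C - {c}. M c' = x})"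
      by (simp add: card_insert_le_m1 card_insert_if)
    also have "\<dots> \<le> Suc (?d x)" using cap by simp
    finally show ?thesis using True d0 by simp
  next
    case False
    then have "{c' \<in> C. (M(c := x0)) c' = x} = {c' \<in> C - {c}. M c' = x}" by auto
    then show ?thesis using cap[rule_format, of x] False by simp
  qed
  moreover have "\<forall>c' \<in> C. lo c' \<le> (M(c := x0)) c' \<and> (M(c := x0)) c' \<le> hi c'"
    using M c \<open>x0 \<le> hi c\<close> by auto
  ultimately show ?case by blast
qed

section \<open>Assigning leaves to the cells of the pyramid\<close>

text \<open>
  The unit cells of the pyramid on \<open>{1..<n}\<close>: \<open>(t, h)\<close> is the cell at height \<open>h\<close> over position \<open>t\<close>.
  It is filled by the move that raises the weight of the spine vertex \<open>t\<close> from \<open>h\<close> to \<open>h + 1\<close>.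
\<close>

definition cells :: "nat \<Rightarrow> (nat \<times> nat) set" where
  "cells n = {(t, h). 1 \<le> h \<and> h \<le> t \<and> t + h \<le> n}"

lemma finite_cells: "finite (cells n)"
  by (rule finite_subset[of _ "{..n} \<times> {..n}"]) (auto simp: cells_def)

text \<open>
  An assignment \<open>M\<close> of a supply position to each cell. The weights have to rise along the way of a
  unit that arrives at a vertex of weight \<open>h\<close>; therefore it is taken from a distance less than \<open>h\<close>.
  The number of leaves at position \<open>x\<close> is \<open>d x\<close>.
\<close>

definition serves :: "nat \<Rightarrow> (nat \<Rightarrow> nat) \<Rightarrow> (nat \<times> nat \<Rightarrow> nat) \<Rightarrow> bool" where
  "serves n d M \<longleftrightarrow> (\<forall>(t, h) \<in> cells n. t < M (t, h) + h \<and> M (t, h) < t + h) \<and>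
     (\<forall>x. card {c \<in> cells n. M c = x} \<le> d x)"

text \<open>
  The cells that can only be served from inside a window \<open>{l..u}\<close> are those whose downward cone
  stands on the window; they form the pyramid on the window. So the lower bounds by
  \<^const>\<open>ell\<close> are precisely the Hall conditions of this assignment problem.
\<close>

lemma serving_exists:
  assumes "\<And>l u. 1 \<le> l \<Longrightarrow> l \<le> u \<Longrightarrow> u < n \<Longrightarrow> ell (u + 1 - l) \<le> (\<Sum>x = l..u. d x)"
  shows "\<exists>M. serves n d M"
proof -
  let ?lo = "\<lambda>(t, h). t + 1 - h" and ?hi = "\<lambda>(t, h). t + h - (1::nat)"
  have "card {c \<in> cells n. l \<le> ?lo c \<and> ?hi c \<le> u} \<le> (\<Sum>x = l..u. d x)" for l u
  proof -
    \<comment> \<open>positions outside \<open>{1..<n}\<close> do not matter, as no cone leaves this interval\<close>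
    define l' where "l' = max l 1"
    define u' where "u' = min u (n - 1)"
    have eq: "{c \<in> cells n. l \<le> ?lo c \<and> ?hi c \<le> u} = Sigma {l'..<u' + 1} (\<lambda>t. {1..pyramid l' (u' + 1) t})"
      by (auto simp: cells_def pyramid_def l'_def u'_def)
    show ?thesis
    proof (cases "l' \<le> u' \<and> u' < n")
      case True
      have "card {c \<in> cells n. l \<le> ?lo c \<and> ?hi c \<le> u} = (\<Sum>t = l'..<u' + 1. pyramid l' (u' + 1) t)"
        unfolding eq by simp
      also have "\<dots> = ell (u' + 1 - l')"
        using sum_pyramid[of l' "u' + 1 - l'"] True by simp
      also have "\<dots> \<le> (\<Sum>x = l'..u'. d x)"
        using True assms[of l' u'] by (simp add: l'_def)
      also have "\<dots> \<le> (\<Sum>x = l..u. d x)"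
        by (rule sum_mono2) (auto simp: l'_def u'_def)
      finally show ?thesis .
    next
      case False
      then have "{l'..<u' + 1} = {}" by (auto simp: l'_def u'_def)
      then show ?thesis unfolding eq by simp
    qed
  qed
  from interval_matching[OF finite_cells this]
  obtain M where "\<forall>c \<in> cells n. ?lo c \<le> M c \<and> M c \<le> ?hi c"
    and cap: "\<forall>x. card {c \<in> cells n. M c = x} \<le> d x" by blast
  then have "serves n d M" unfolding serves_def by (fastforce simp: cells_def)
  then show ?thesis by blast
qed

section \<open>An acyclic order on the cells\<close>

text \<open>
  Paths are put into a normal form that uses only one of the relations \<open>P\<close> and \<open>Q\<close>: by \<open>core\<close>, when a
  \<open>P\<close>-step is followed by a \<open>Q\<close>-step, up to steps of \<open>L\<close> in between, one of the two can be
  absorbed into \<open>L\<close>.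
\<close>

lemma path_composition:
  assumes "trans L"
    and core: "\<And>u p v q. (u, p) \<in> P \<Longrightarrow> (p, v) \<in> L\<^sup>= \<Longrightarrow> (v, q) \<in> Q \<Longrightarrow> (u, v) \<in> L\<^sup>= \<or> (p, q) \<in> L\<^sup>="
    and "(w, v) \<in> (L \<union> P)\<^sup>*" and "(v, v') \<in> L\<^sup>=" and "(v', q) \<in> Q"
  shows "(w, q) \<in> (L \<union> P)\<^sup>+ \<union> (L \<union> Q)\<^sup>+"
  using assms(3,4)
proof (induction rule: rtrancl_induct)
  case base
  then show ?case using \<open>(v', q) \<in> Q\<close> by (auto intro: trancl_into_trancl2)
next
  case (step u p)
  show ?case
  proof (cases "(u, p) \<in> L")
    case True
    then have "(u, v') \<in> L\<^sup>=" using step.prems \<open>trans L\<close> by (auto dest: transD)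
    then show ?thesis by (rule step.IH)
  next
    case False
    then have "(u, p) \<in> P" using step.hyps(2) by simp
    then consider "(u, v') \<in> L\<^sup>=" | "(p, q) \<in> L\<^sup>="
      using core step.prems \<open>(v', q) \<in> Q\<close> by blast
    then show ?thesis
    proof cases
      case 1
      then show ?thesis by (rule step.IH)
    next
      case 2
      have "(w, p) \<in> (L \<union> P)\<^sup>+" using step.hyps by (rule rtrancl_into_trancl1)
      with 2 show ?thesis by (auto intro: trancl_into_trancl)
    qed
  qed
qed

lemma acyclic_union:
  assumes "trans L"
    and PQ: "\<And>u p v q. (u, p) \<in> P \<Longrightarrow> (p, v) \<in> L\<^sup>= \<Longrightarrow> (v, q) \<in> Q \<Longrightarrow> (u, v) \<in> L\<^sup>= \<or> (p, q) \<in> L\<^sup>="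
    and QP: "\<And>u p v q. (u, p) \<in> Q \<Longrightarrow> (p, v) \<in> L\<^sup>= \<Longrightarrow> (v, q) \<in> P \<Longrightarrow> (u, v) \<in> L\<^sup>= \<or> (p, q) \<in> L\<^sup>="
    and "acyclic (L \<union> P)" "acyclic (L \<union> Q)"
  shows "acyclic (L \<union> P \<union> Q)"
proof -
  have "(w, q) \<in> (L \<union> P)\<^sup>+ \<union> (L \<union> Q)\<^sup>+" if "(w, q) \<in> (L \<union> P \<union> Q)\<^sup>+" for w q
    using that
  proof (induction rule: trancl_induct)
    case (base y)
    then show ?case by auto
  next
    case (step v q)
    from step.IH show ?case
    proof
      assume wv: "(w, v) \<in> (L \<union> P)\<^sup>+"
      show ?thesis
      proof (cases "(v, q) \<in> L \<union> P")
        case True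
        with wv show ?thesis by (blast intro: trancl_into_trancl)
      next
        case False
        then have "(v, q) \<in> Q" using step.hyps by blast
        then show ?thesis
          using path_composition[OF \<open>trans L\<close> PQ trancl_into_rtrancl[OF wv]] by blast
      qed
    next
      assume wv: "(w, v) \<in> (L \<union> Q)\<^sup>+"
      show ?thesis
      proof (cases "(v, q) \<in> L \<union> Q")
        case True
        with wv show ?thesis by (blast intro: trancl_into_trancl)
      next
        case False
        then have "(v, q) \<in> P" using step.hyps by blast
        then show ?thesis
          using path_composition[OF \<open>trans L\<close> QP trancl_into_rtrancl[OF wv]] by blast
      qed
    qed
  qed
  then show ?thesis using assms(4,5) unfolding acyclic_def by blast
qed

text \<open>
  A spine profile grows evenly, with neighbouring weights differing by at most one, if a cell is
  filled only after all cells of its downward cone.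
\<close>

definition below :: "nat \<Rightarrow> ((nat \<times> nat) \<times> (nat \<times> nat)) set" where
  "below n = {((t, h), (t', h')). (t, h) \<in> cells n \<and> (t', h') \<in> cells n \<and> (t, h) \<noteq> (t', h') \<and>
     t + h \<le> t' + h' \<and> h + t' \<le> h' + t}"

text \<open>
  If a cell \<open>(t, h)\<close> is served from a position \<open>M (t, h) > t\<close>, then at that moment the weights must
  descend from \<open>t\<close> towards \<open>M (t, h)\<close>. This forces the cells on the diagonal from
  \<open>(t + 1, h)\<close> down to the right to be still unfilled, as far as the supplier: \<open>(t, h)\<close> precedes them.
\<close>

definition rightward :: "nat \<Rightarrow> (nat \<times> nat \<Rightarrow> nat) \<Rightarrow> ((nat \<times> nat) \<times> (nat \<times> nat)) set" where
  "rightward n M = {((t, h), (t', h')). (t, h) \<in> cells n \<and> (t', h') \<in> cells n \<and>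
     t < t' \<and> t' \<le> M (t, h) \<and> t' + h' = t + h + 1}"

definition leftward :: "nat \<Rightarrow> (nat \<times> nat \<Rightarrow> nat) \<Rightarrow> ((nat \<times> nat) \<times> (nat \<times> nat)) set" where
  "leftward n M = {((t, h), (t', h')). (t, h) \<in> cells n \<and> (t', h') \<in> cells n \<and>
     t' < t \<and> M (t, h) \<le> t' \<and> h' + t = h + t' + 1}"

definition cost :: "nat \<Rightarrow> (nat \<times> nat \<Rightarrow> nat) \<Rightarrow> nat" where
  "cost n M = (\<Sum>(t, h) \<in> cells n. (M (t, h) - t) + (t - M (t, h)))"

text \<open>
  Two cells that are served across each other can exchange their suppliers, which shortens the total
  distance. The last two hypotheses guarantee that the exchanged suppliers are still within reach.
\<close>

lemma swap_improves:
  assumes M: "serves n d M" and u: "(t, h) \<in> cells n" and v: "(t', h') \<in> cells n"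
    and "t < M (t, h)" "M (t', h') < t'" "t < t'" "M (t', h') < M (t, h)"
    and "t + h \<le> t' + h'" "h' + t \<le> h + t'"
  shows "\<exists>M'. serves n d M' \<and> cost n M' < cost n M"
proof -
  let ?u = "(t, h)" and ?v = "(t', h')"
  define x where "x = M ?u"
  define y where "y = M ?v"
  let ?M = "M(?u := y, ?v := x)"
  have ne: "?u \<noteq> ?v" using \<open>t < t'\<close> by simp
  have near: "t < x + h" "x < t + h" "t' < y + h'" "y < t' + h'"
    using M u v unfolding serves_def x_def y_def by auto
  have lt: "t < x" "y < t'" "y < x" using assms by (auto simp: x_def y_def)
  have "card {c \<in> cells n. ?M c = z} = card {c \<in> cells n. M c = z}" for z
  proof (rule bij_betw_same_card)
    show "bij_betw (id(?u := ?v, ?v := ?u)) {c \<in> cells n. ?M c = z} {c \<in> cells n. M c = z}"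
      by (rule bij_betw_byWitness[where f' = "id(?u := ?v, ?v := ?u)"])
        (use ne u v in \<open>auto simp: x_def y_def split: if_splits\<close>)
  qed
  then have "serves n d ?M"
    using M near lt assms(6,8,9) unfolding serves_def by auto
  moreover have "cost n ?M < cost n M"
  proof -
    let ?f = "\<lambda>M (t, h). (M (t, h) - t) + (t - M (t, h)) :: nat"
    let ?R = "cells n - {?u} - {?v}"
    have split: "cost n N = ?f N ?u + (?f N ?v + sum (?f N) ?R)" for N
      unfolding cost_def using u v ne finite_cells[of n]
      by (subst sum.remove[of _ ?u], simp, simp) (subst sum.remove[of _ ?v], auto)
    have "sum (?f ?M) ?R = sum (?f M) ?R"
    proof (rule sum.cong)
      fix c assume "c \<in> ?R"
      then have "?M c = M c" by auto
      then show "?f ?M c = ?f M c" by (cases c) (simp del: fun_upd_apply)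
    qed simp
    moreover have "?f ?M ?u + ?f ?M ?v < ?f M ?u + ?f M ?v"
      using lt \<open>t < t'\<close> ne by (auto simp: x_def y_def)
    ultimately show ?thesis unfolding split by linarith
  qed
  ultimately show ?thesis by blast
qed

text \<open>
  A step \<open>rightward\<close> followed by a step \<open>leftward\<close> moves to the right and back. Unless one of the steps
  is already implied by the cone order, the two cells involved are served across each other, which an
  assignment of least cost excludes by \<open>swap_improves\<close>. Hence a cycle could use steps in one
  direction only, and such steps, like the cone order, never decrease \<open>t + h\<close> (for \<open>rightward\<close>) or
  \<open>h - t\<close> (for \<open>leftward\<close>).
\<close>

lemma acyclic_precedence:
  assumes M: "serves n d M" and opt: "\<And>M'. serves n d M' \<Longrightarrow> cost n M \<le> cost n M'"
  shows "acyclic (below n \<union> rightward n M \<union> leftward n M)"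
proof (rule acyclic_union)
  note defs = below_def rightward_def leftward_def
  show "trans (below n)" by (rule transI) (auto simp: below_def)
  have noswap: "\<not> (t < M (t, h) \<and> M (t', h') < t' \<and> t < t' \<and> M (t', h') < M (t, h) \<and>
      t + h \<le> t' + h' \<and> h' + t \<le> h + t')"
    if "(t, h) \<in> cells n" "(t', h') \<in> cells n" for t h t' h'
    using swap_improves[OF M that] opt by (meson not_less)
  show "(u, v) \<in> (below n)\<^sup>= \<or> (p, q) \<in> (below n)\<^sup>="
    if "(u, p) \<in> rightward n M" "(p, v) \<in> (below n)\<^sup>=" "(v, q) \<in> leftward n M" for u p v q
  proof (rule ccontr)
    assume neg: "\<not> ?thesis"
    obtain t h tp hp t' h' tq hq where eq: "u = (t, h)" "p = (tp, hp)" "v = (t', h')" "q = (tq, hq)"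
      by (metis surj_pair)
    have cs: "(t, h) \<in> cells n" "(tp, hp) \<in> cells n" "(t', h') \<in> cells n" "(tq, hq) \<in> cells n"
      using that eq by (auto simp: defs)
    have f: "t < tp" "tp \<le> M (t, h)" "tp + hp = t + h + 1" "tp + hp \<le> t' + h'" "hp + t' \<le> h' + tp"
      "tq < t'" "M (t', h') \<le> tq" "hq + t' = h' + tq + 1"
      using that eq by (auto simp: defs)
    have "\<not> (t + h \<le> t' + h' \<and> h + t' \<le> h' + t)" "\<not> (tp + hp \<le> tq + hq \<and> hp + tq \<le> hq + tp)"
      using neg eq cs by (auto simp: below_def)
    then show False using noswap[OF cs(1,3)] f by linarith
  qed
  show "(u, v) \<in> (below n)\<^sup>= \<or> (p, q) \<in> (below n)\<^sup>="
    if "(u, p) \<in> leftward n M" "(p, v) \<in> (below n)\<^sup>=" "(v, q) \<in> rightward n M" for u p v q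
  proof (rule ccontr)
    assume neg: "\<not> ?thesis"
    obtain t h tp hp t' h' tq hq where eq: "u = (t, h)" "p = (tp, hp)" "v = (t', h')" "q = (tq, hq)"
      by (metis surj_pair)
    have cs: "(t, h) \<in> cells n" "(tp, hp) \<in> cells n" "(t', h') \<in> cells n" "(tq, hq) \<in> cells n"
      using that eq by (auto simp: defs)
    have f: "tp < t" "M (t, h) \<le> tp" "hp + t = h + tp + 1" "tp + hp \<le> t' + h'" "hp + t' \<le> h' + tp"
      "t' < tq" "tq \<le> M (t', h')" "tq + hq = t' + h' + 1"
      using that eq by (auto simp: defs)
    have "\<not> (t + h \<le> t' + h' \<and> h + t' \<le> h' + t)" "\<not> (tp + hp \<le> tq + hq \<and> hp + tq \<le> hq + tp)"
      using neg eq cs by (auto simp: below_def)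
    then show False using noswap[OF cs(3,1)] f by linarith
  qed
  have small: "t \<le> n" "h \<le> n" if "(t, h) \<in> cells n" for t h using that by (auto simp: cells_def)
  show "acyclic (below n \<union> rightward n M)"
  \<comment> \<open>the factor \<open>n + 1\<close> makes \<open>t + h\<close> dominate and leaves \<open>h\<close> to break ties\<close>
  proof (rule acyclicI_order[where f = "\<lambda>(t, h). - (int (t + h) * (int n + 1) + int h)"])
    fix u v assume uv: "(u, v) \<in> below n \<union> rightward n M"
    obtain t h t' h' where eq: "u = (t, h)" "v = (t', h')" by (metis surj_pair)
    have "t + h = t' + h' \<and> h < h' \<or> t + h < t' + h'" "h \<le> n"
      using uv small by (auto simp: eq below_def rightward_def)
    then have "int (t + h) * (int n + 1) + int h < int (t' + h') * (int n + 1) + int h'"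
    proof (elim disjE)
      assume "t + h < t' + h'"
      then have "int (t + h) + 1 \<le> int (t' + h')" by simp
      then have "(int (t + h) + 1) * (int n + 1) \<le> int (t' + h') * (int n + 1)"
        by (rule mult_right_mono) simp
      then show ?thesis using \<open>h \<le> n\<close> by (simp add: algebra_simps)
    qed simp
    then show "(case v of (t, h) \<Rightarrow> - (int (t + h) * (int n + 1) + int h))
        < (case u of (t, h) \<Rightarrow> - (int (t + h) * (int n + 1) + int h))"
      by (simp add: eq)
  qed
  show "acyclic (below n \<union> leftward n M)"
  proof (rule acyclicI_order[where f = "\<lambda>(t, h). - ((int h - int t) * (int n + 1) + int h)"])
    fix u v assume uv: "(u, v) \<in> below n \<union> leftward n M"
    obtain t h t' h' where eq: "u = (t, h)" "v = (t', h')" by (metis surj_pair)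
    have "int h - int t = int h' - int t' \<and> h < h' \<or> int h - int t < int h' - int t'" "h \<le> n"
      using uv small by (auto simp: eq below_def leftward_def)
    then have "(int h - int t) * (int n + 1) + int h < (int h' - int t') * (int n + 1) + int h'"
    proof (elim disjE)
      assume "int h - int t < int h' - int t'"
      then have "(int h - int t) + 1 \<le> int h' - int t'" by simp
      then have "((int h - int t) + 1) * (int n + 1) \<le> (int h' - int t') * (int n + 1)"
        by (rule mult_right_mono) simp
      then show ?thesis using \<open>h \<le> n\<close> by (simp add: algebra_simps)
    qed simp
    then show "(case v of (t, h) \<Rightarrow> - ((int h - int t) * (int n + 1) + int h))
        < (case u of (t, h) \<Rightarrow> - ((int h - int t) * (int n + 1) + int h))"
      by (simp add: eq)
  qed
qed

section \<open>Acquisition moves along a path with pending leaves\<close>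

text \<open>
  The game with every leaf of weight at most one. In a state \<open>(W, r)\<close> the spine vertices are
  \<open>0, \<dots>, n\<close>, the weight of \<open>j\<close> is \<open>W j\<close>, and \<open>r j\<close> leaves adjacent to \<open>j\<close> still have their unit.
\<close>

inductive path_move :: "nat \<Rightarrow> (nat \<Rightarrow> nat) \<times> (nat \<Rightarrow> nat) \<Rightarrow> (nat \<Rightarrow> nat) \<times> (nat \<Rightarrow> nat) \<Rightarrow> bool"
  for n where
  absorb: "j \<le> n \<Longrightarrow> 0 < r j \<Longrightarrow> 0 < W j \<Longrightarrow> path_move n (W, r) (W(j := W j + 1), r(j := r j - 1))"
| shift: "a \<le> n \<Longrightarrow> b \<le> n \<Longrightarrow> b = Suc a \<or> a = Suc b \<Longrightarrow> 0 < W a \<Longrightarrow> W a \<le> W b \<Longrightarrow>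
    path_move n (W, r) (W(a := W a - 1, b := W b + 1), r)"

abbreviation reaches :: "nat \<Rightarrow> (nat \<Rightarrow> nat) \<times> (nat \<Rightarrow> nat) \<Rightarrow> (nat \<Rightarrow> nat) \<times> (nat \<Rightarrow> nat) \<Rightarrow> bool" where
  "reaches n \<equiv> (path_move n)\<^sup>*\<^sup>*"

text \<open>
  A single unit can be carried uphill from \<open>a\<close> to \<open>x\<close>: once it has left \<open>a\<close>, each vertex that holds it
  exceeds its old weight by one, which strict growth of the weights permits.
\<close>

lemma climb_right:
  assumes "a < x" "x \<le> n" "0 < W a" "W a \<le> W (Suc a)" "\<And>j. a < j \<Longrightarrow> j < x \<Longrightarrow> W j < W (Suc j)"
  shows "reaches n (W, r) (W(a := W a - 1, x := W x + 1), r)"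
  using assms
proof (induction "x - a" arbitrary: a W)
  case (Suc m)
  note up = Suc.prems(5)
  let ?W = "W(a := W a - 1, Suc a := W (Suc a) + 1)"
  have mv: "path_move n (W, r) (?W, r)" using Suc.prems(1-4) by (intro shift) auto
  show ?case
  proof (cases "Suc a = x")
    case True
    then show ?thesis using mv by auto
  next
    case False
    then have lt: "Suc a < x" using Suc.prems(1) by simp
    have "reaches n (?W, r) (?W(Suc a := ?W (Suc a) - 1, x := ?W x + 1), r)"
    proof (rule Suc.hyps(1))
      show "?W (Suc a) \<le> ?W (Suc (Suc a))" using up[of "Suc a"] lt by simp
      show "?W j < ?W (Suc j)" if "Suc a < j" "j < x" for j using up[of j] that by simp
    qed (use lt Suc.prems(2) Suc.hyps(2) in auto)
    moreover have "?W(Suc a := ?W (Suc a) - 1, x := ?W x + 1) = W(a := W a - 1, x := W x + 1)"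
      using lt by (auto simp: fun_eq_iff)
    ultimately have "reaches n (?W, r) (W(a := W a - 1, x := W x + 1), r)" by (simp only:)
    with mv show ?thesis by (rule converse_rtranclp_into_rtranclp)
  qed
qed simp

lemma climb_left:
  assumes "x < a" "a \<le> n" "0 < W a" "W a \<le> W (a - 1)" "\<And>j. x < j \<Longrightarrow> j < a \<Longrightarrow> W j < W (j - 1)"
  shows "reaches n (W, r) (W(a := W a - 1, x := W x + 1), r)"
  using assms
proof (induction "a - x" arbitrary: a W)
  case (Suc m)
  note up = Suc.prems(5)
  obtain b where a: "a = Suc b" using Suc.prems(1) by (cases a) auto
  let ?W = "W(a := W a - 1, b := W b + 1)"
  have mv: "path_move n (W, r) (?W, r)" using Suc.prems(1-4) a by (intro shift) auto
  show ?case
  proof (cases "b = x")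
    case True
    then show ?thesis using mv by auto
  next
    case False
    then have lt: "x < b" using Suc.prems(1) a by simp
    have "reaches n (?W, r) (?W(b := ?W b - 1, x := ?W x + 1), r)"
    proof (rule Suc.hyps(1))
      show "?W b \<le> ?W (b - 1)" using up[of b] lt a by auto
      show "?W j < ?W (j - 1)" if "x < j" "j < b" for j using up[of j] that a by auto
    qed (use lt Suc.prems(2) Suc.hyps(2) a in auto)
    moreover have "?W(b := ?W b - 1, x := ?W x + 1) = W(a := W a - 1, x := W x + 1)"
      using lt a by (auto simp: fun_eq_iff)
    ultimately have "reaches n (?W, r) (W(a := W a - 1, x := W x + 1), r)" by (simp only:)
    with mv show ?thesis by (rule converse_rtranclp_into_rtranclp)
  qed
qed simp

text \<open>
  The same net effect with the steps in opposite order: the vertex before \<open>x\<close> gives a unit first and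
  is then refilled from behind. Here the tie is permitted at the end instead of the beginning.
\<close>

lemma cascade_right:
  assumes "a < x" "x \<le> n" "0 < W a" "W (x - 1) \<le> W x" "\<And>j. a < j \<Longrightarrow> j < x \<Longrightarrow> W (j - 1) < W j"
  shows "reaches n (W, r) (W(a := W a - 1, x := W x + 1), r)"
  using assms
proof (induction "x - a" arbitrary: x W)
  case (Suc m)
  note up = Suc.prems(5)
  obtain y where x: "x = Suc y" using Suc.prems(1) by (cases x) auto
  let ?W = "W(y := W y - 1, x := W x + 1)"
  have pos: "0 < W y"
    using Suc.prems(1,3) up[of y] x by (cases "a = y") auto
  have mv: "path_move n (W, r) (?W, r)" using Suc.prems(1-4) pos x by (intro shift) auto
  show ?case
  proof (cases "a = y")
    case True
    then show ?thesis using mv by auto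
  next
    case False
    then have lt: "a < y" using Suc.prems(1) x by simp
    have "reaches n (?W, r) (?W(a := ?W a - 1, y := ?W y + 1), r)"
    proof (rule Suc.hyps(1))
      show "?W (y - 1) \<le> ?W y" using up[of y] lt x by auto
      show "?W (j - 1) < ?W j" if "a < j" "j < y" for j using up[of j] that x by auto
    qed (use lt Suc.prems(2,3) Suc.hyps(2) x in auto)
    moreover have "?W(a := ?W a - 1, y := ?W y + 1) = W(a := W a - 1, x := W x + 1)"
      using lt pos x by (auto simp: fun_eq_iff)
    ultimately have "reaches n (?W, r) (W(a := W a - 1, x := W x + 1), r)" by (simp only:)
    with mv show ?thesis by (rule converse_rtranclp_into_rtranclp)
  qed
qed simp

lemma cascade_left:
  assumes "x < a" "a \<le> n" "0 < W a" "W (Suc x) \<le> W x" "\<And>j. x < j \<Longrightarrow> j < a \<Longrightarrow> W (Suc j) < W j"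
  shows "reaches n (W, r) (W(a := W a - 1, x := W x + 1), r)"
  using assms
proof (induction "a - x" arbitrary: x W)
  case (Suc m)
  note up = Suc.prems(5)
  let ?W = "W(Suc x := W (Suc x) - 1, x := W x + 1)"
  have pos: "0 < W (Suc x)"
    using Suc.prems(1,3) up[of "Suc x"] by (cases "a = Suc x") auto
  have mv: "path_move n (W, r) (?W, r)" using Suc.prems(1-4) pos by (intro shift) auto
  show ?case
  proof (cases "a = Suc x")
    case True
    then show ?thesis using mv by auto
  next
    case False
    then have lt: "Suc x < a" using Suc.prems(1) by simp
    have "reaches n (?W, r) (?W(a := ?W a - 1, Suc x := ?W (Suc x) + 1), r)"
    proof (rule Suc.hyps(1))
      show "?W (Suc (Suc x)) \<le> ?W (Suc x)" using up[of "Suc x"] lt by simp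
      show "?W (Suc j) < ?W j" if "Suc x < j" "j < a" for j using up[of j] that by simp
    qed (use lt Suc.prems(2,3) Suc.hyps(2) in auto)
    moreover have "?W(a := ?W a - 1, Suc x := ?W (Suc x) + 1) = W(a := W a - 1, x := W x + 1)"
      using lt pos by (auto simp: fun_eq_iff)
    ultimately have "reaches n (?W, r) (W(a := W a - 1, x := W x + 1), r)" by (simp only:)
    with mv show ?thesis by (rule converse_rtranclp_into_rtranclp)
  qed
qed simp

section \<open>Filling the pyramid\<close>

text \<open>
  The weights when exactly the cells in \<open>F\<close> have been filled.
\<close>

definition level :: "(nat \<times> nat) set \<Rightarrow> nat \<Rightarrow> nat" where
  "level F t = Suc (card {h. (t, h) \<in> F})"

definition unused :: "(nat \<Rightarrow> nat) \<Rightarrow> (nat \<times> nat \<Rightarrow> nat) \<Rightarrow> (nat \<times> nat) set \<Rightarrow> nat \<Rightarrow> nat" where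
  "unused d M F x = d x - card {c \<in> F. M c = x}"

lemma level_eq:
  assumes "F \<subseteq> cells n" and closed: "\<And>c c'. (c, c') \<in> below n \<Longrightarrow> c' \<in> F \<Longrightarrow> c \<in> F"
    and "g = 0 \<or> (t, g) \<in> F" "(t, Suc g) \<notin> F"
  shows "level F t = Suc g"
proof -
  have "h \<le> g" if "(t, h) \<in> F" for h
  proof (rule ccontr)
    assume "\<not> h \<le> g"
    with that assms(1,4) have "Suc g < h" by (metis not_less_eq_eq nat_less_le)
    with that assms(1) have "((t, Suc g), (t, h)) \<in> below n" by (auto simp: below_def cells_def)
    then show False using closed that assms(4) by blast
  qed
  moreover have "(t, h) \<in> F" if "1 \<le> h" "h \<le> g" for h
  proof (cases "h = g")
    case True
    then show ?thesis using assms(3) that by auto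
  next
    case False
    then have "(t, g) \<in> F" using assms(3) that by auto
    moreover from this have "((t, h), (t, g)) \<in> below n"
      using assms(1) that False by (auto simp: below_def cells_def)
    ultimately show ?thesis using closed by blast
  qed
  moreover have "1 \<le> h" if "(t, h) \<in> F" for h using that assms(1) by (auto simp: cells_def)
  ultimately have "(t, h) \<in> F \<longleftrightarrow> h \<in> {1..g}" for h by (meson atLeastAtMost_iff)
  then have "{h. (t, h) \<in> F} = {1..g}" by blast
  then show ?thesis by (simp add: level_def)
qed

text \<open>
  The precedence relations determine the weights between a cell \<open>(t, h)\<close> and its supplier \<open>x\<close>
  when it is the turn of this cell. By the cone order the cells with coordinate sum
  \<open>t + h\<close> (for \<open>t < x\<close>) are filled, and by \<open>rightward\<close> the ones above them are not. So the weights
  from \<open>t\<close> to \<open>x\<close> read \<open>h, h, h - 1, \<dots>\<close>, with at least \<open>2\<close> at \<open>x\<close>. A cascade moves one unit from \<open>x\<close>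
  to \<open>t\<close>, and a leaf of \<open>x\<close> replaces it.
\<close>

lemma fill_cell:
  assumes M: "serves n d M" and F: "F \<subseteq> cells n" and c: "(t, h) \<in> cells n" "(t, h) \<notin> F"
    and closed: "\<And>c c'. (c, c') \<in> below n \<union> rightward n M \<union> leftward n M \<Longrightarrow> c' \<in> F \<Longrightarrow> c \<in> F"
    and preds: "\<And>c. (c, (t, h)) \<in> below n \<Longrightarrow> c \<in> F"
  shows "reaches n (level F, unused d M F) (level (insert (t, h) F), unused d M (insert (t, h) F))"
proof -
  let ?c = "(t, h)" and ?W = "level F" and ?r = "unused d M F"
  define x where "x = M ?c"
  have fin: "finite F" using F finite_cells finite_subset by blast
  have x: "t < x + h" "x < t + h" using M c unfolding serves_def x_def by auto
  have h: "1 \<le> h" "h \<le> t" "t + h \<le> n" using c(1) by (auto simp: cells_def)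
  have "x \<le> n" using x h by simp
  have W_t: "?W t = h"
  proof -
    have "h - 1 = 0 \<or> (t, h - 1) \<in> F"
    proof (rule disjCI)
      assume "(t, h - 1) \<notin> F"
      then have "((t, h - 1), (t, h)) \<notin> below n" using preds by blast
      then show "h - 1 = 0" using c(1) by (auto simp: below_def cells_def)
    qed
    then have "?W t = Suc (h - 1)"
      using c(2) h closed by (intro level_eq[OF F]) auto
    then show ?thesis using h by simp
  qed
  have W_left: "?W y = h + t + 1 - y" if "t < y" "y \<le> x" for y
  proof -
    define g where "g = t + h - y"
    have g: "y + g = t + h" using that x by (simp add: g_def)
    have "(y, g) \<in> F"
      using preds[of "(y, g)"] c(1) that x g by (auto simp: below_def cells_def)
    moreover have "(y, Suc g) \<notin> F"
    proof
      assume *: "(y, Suc g) \<in> F"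
      then have "((t, h), (y, Suc g)) \<in> rightward n M"
        using F c that x g by (auto simp: rightward_def x_def[symmetric])
      then show False using closed * c(2) by blast
    qed
    ultimately have "?W y = Suc g" using closed by (intro level_eq[OF F]) auto
    then show ?thesis using that x g by simp
  qed
  have W_right: "?W y = h + y + 1 - t" if "x \<le> y" "y < t" for y
  proof -
    define g where "g = h + y - t"
    have g: "t + g = h + y" using that x by (simp add: g_def)
    have "(y, g) \<in> F"
      using preds[of "(y, g)"] c(1) that x g by (auto simp: below_def cells_def)
    moreover have "(y, Suc g) \<notin> F"
    proof
      assume *: "(y, Suc g) \<in> F"
      then have "((t, h), (y, Suc g)) \<in> leftward n M"
        using F c that x g by (auto simp: leftward_def x_def[symmetric])
      then show False using closed * c(2) by blast
    qed
    ultimately have "?W y = Suc g" using closed by (intro level_eq[OF F]) auto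
    then show ?thesis using that x g by simp
  qed
  have r: "0 < ?r x"
  proof -
    have "card (insert ?c {c \<in> F. M c = x}) \<le> card {c \<in> cells n. M c = x}"
      using F c by (intro card_mono) (auto simp: x_def finite_cells)
    also have "\<dots> \<le> d x" using M by (auto simp: serves_def)
    finally show ?thesis using c(2) fin by (simp add: unused_def)
  qed
  have W': "level (insert ?c F) = ?W(t := h + 1)"
  proof
    fix y
    show "level (insert ?c F) y = (?W(t := h + 1)) y"
    proof (cases "y = t")
      case True
      have "{h'. (t, h') \<in> insert ?c F} = insert h {h'. (t, h') \<in> F}" by auto
      moreover have "finite {h'. (t, h') \<in> F}"
        using finite_imageI[OF fin, of snd] by (rule rev_finite_subset) force
      ultimately show ?thesis using True c(2) W_t by (simp add: level_def)
    qed (simp add: level_def)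
  qed
  have r': "unused d M (insert ?c F) = ?r(x := ?r x - 1)"
  proof
    fix y
    show "unused d M (insert ?c F) y = (?r(x := ?r x - 1)) y"
    proof (cases "y = x")
      case True
      then have "{c' \<in> insert ?c F. M c' = y} = insert ?c {c \<in> F. M c = x}" by (auto simp: x_def)
      then show ?thesis using True c(2) fin by (simp add: unused_def)
    next
      case False
      then have "{c' \<in> insert ?c F. M c' = y} = {c' \<in> F. M c' = y}" by (auto simp: x_def)
      then show ?thesis using False by (simp add: unused_def)
    qed
  qed
  consider "x = t" | "t < x" | "x < t" by linarith
  then show ?thesis
  proof cases
    case 1
    have "path_move n (?W, ?r) (?W(x := ?W x + 1), ?r(x := ?r x - 1))"
      using r W_t h 1 by (intro absorb) auto
    then show ?thesis unfolding W' r' using 1 W_t by auto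
  next
    case 2
    let ?V = "?W(x := ?W x - 1, t := ?W t + 1)"
    have "reaches n (?W, ?r) (?V, ?r)"
      using 2 x W_t W_left \<open>x \<le> n\<close> by (intro cascade_left) auto
    moreover have "path_move n (?V, ?r) (?V(x := ?V x + 1), ?r(x := ?r x - 1))"
      using r 2 x W_left[of x] \<open>x \<le> n\<close> by (intro absorb) auto
    moreover have "?V(x := ?V x + 1) = ?W(t := h + 1)"
      using 2 W_t W_left[of x] x by (auto simp: fun_eq_iff)
    ultimately show ?thesis unfolding W' r' by (metis rtranclp.rtrancl_into_rtrancl)
  next
    case 3
    let ?V = "?W(x := ?W x - 1, t := ?W t + 1)"
    have "reaches n (?W, ?r) (?V, ?r)"
      using 3 x h W_t W_right by (intro cascade_right) auto
    moreover have "path_move n (?V, ?r) (?V(x := ?V x + 1), ?r(x := ?r x - 1))"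
      using r 3 x W_right[of x] \<open>x \<le> n\<close> by (intro absorb) auto
    moreover have "?V(x := ?V x + 1) = ?W(t := h + 1)"
      using 3 W_t W_right[of x] x by (auto simp: fun_eq_iff)
    ultimately show ?thesis unfolding W' r' by (metis rtranclp.rtrancl_into_rtrancl)
  qed
qed

text \<open>
  The cells are filled one by one, along a linear extension of the acyclic precedence relation.
\<close>

lemma pyramid_reachable:
  assumes M: "serves n d M" and opt: "\<And>M'. serves n d M' \<Longrightarrow> cost n M \<le> cost n M'"
  shows "reaches n (\<lambda>_. 1, d) (level (cells n), unused d M (cells n))"
proof -
  let ?E = "below n \<union> rightward n M \<union> leftward n M"
  have E: "?E \<subseteq> cells n \<times> cells n"
    by (auto simp: below_def rightward_def leftward_def)
  have "wf ?E"
    using acyclic_precedence[OF assms] E finite_cells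
    by (intro finite_acyclic_wf) (auto intro: finite_subset)
  have "\<exists>F \<subseteq> cells n. card F = m \<and> (\<forall>c c'. (c, c') \<in> ?E \<longrightarrow> c' \<in> F \<longrightarrow> c \<in> F) \<and>
      reaches n (\<lambda>_. 1, d) (level F, unused d M F)" if "m \<le> card (cells n)" for m
    using that
  proof (induction m)
    case 0
    have "(level {}, unused d M {}) = (\<lambda>_. 1, d)"
      by (simp add: level_def unused_def fun_eq_iff)
    then show ?case by (intro exI[of _ "{}"]) auto
  next
    case (Suc m)
    then obtain F where F: "F \<subseteq> cells n" "card F = m"
      and closed: "\<And>c c'. (c, c') \<in> ?E \<Longrightarrow> c' \<in> F \<Longrightarrow> c \<in> F"
      and reach: "reaches n (\<lambda>_. 1, d) (level F, unused d M F)"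
      by (metis Suc_leD)
    have "F \<noteq> cells n" using F Suc.prems by auto
    then obtain c0 where "c0 \<in> cells n - F" using F by blast
    then obtain c where c: "c \<in> cells n - F" and cmin: "\<And>c'. (c', c) \<in> ?E \<Longrightarrow> c' \<notin> cells n - F"
      using wfE_min[OF \<open>wf ?E\<close>, of c0 "cells n - F"] by metis
    have preds: "c' \<in> F" if "(c', c) \<in> ?E" for c' using cmin[OF that] that E by blast
    obtain t h where th: "c = (t, h)" by fastforce
    have "reaches n (level F, unused d M F) (level (insert (t, h) F), unused d M (insert (t, h) F))"
    proof (rule fill_cell[OF M F(1)])
      show "c1 \<in> F" if "(c1, c2) \<in> ?E" "c2 \<in> F" for c1 c2 using closed that by blast
      show "c' \<in> F" if "(c', (t, h)) \<in> below n" for c' using preds that th by blast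
    qed (use c th in auto)
    with reach have "reaches n (\<lambda>_. 1, d) (level (insert c F), unused d M (insert c F))"
      unfolding th by (rule rtranclp_trans)
    moreover have "card (insert c F) = Suc m"
      using F c finite_subset[OF F(1) finite_cells] by simp
    ultimately show ?case
      using F c closed preds by (intro exI[of _ "insert c F"]) blast
  qed
  from this[of "card (cells n)"] obtain F where "F \<subseteq> cells n" "card F = card (cells n)"
    "reaches n (\<lambda>_. 1, d) (level F, unused d M F)" by auto
  moreover from this(1,2) have "F = cells n" by (rule card_subset_eq[OF finite_cells])
  ultimately show ?thesis by simp
qed

lemma level_cells: "level (cells n) t = Suc (min t (n - t))"
proof -
  have "{h. (t, h) \<in> cells n} = {1..min t (n - t)}" by (auto simp: cells_def)
  then show ?thesis by (simp add: level_def)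
qed

section \<open>Gathering all weight at the peak\<close>

definition peaked :: "nat \<Rightarrow> nat \<Rightarrow> nat \<Rightarrow> (nat \<Rightarrow> nat) \<Rightarrow> bool" where
  "peaked a x b W \<longleftrightarrow> a \<le> x \<and> x \<le> b \<and> 0 < W a \<and> 0 < W b \<and>
     (\<forall>j. a \<le> j \<and> j < x \<longrightarrow> W j < W (Suc j)) \<and> (\<forall>j. x \<le> j \<and> j < b \<longrightarrow> W (Suc j) < W j)"

lemma peaked_pos:
  assumes "peaked a x b W" "a \<le> j" "j \<le> b"
  shows "0 < W j"
proof (cases "j \<le> x")
  case True
  show ?thesis
  proof (cases "j = a")
    case False
    then obtain i where "j = Suc i" "a \<le> i" "i < x" using assms(2) True by (cases j) auto
    then have "W i < W j" using assms(1) unfolding peaked_def by blast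
    then show ?thesis by simp
  qed (use assms in \<open>simp add: peaked_def\<close>)
next
  case False
  show ?thesis
  proof (cases "j = b")
    case False
    then have "W (Suc j) < W j" using assms \<open>\<not> j \<le> x\<close> unfolding peaked_def by simp
    then show ?thesis by simp
  qed (use assms in \<open>simp add: peaked_def\<close>)
qed

text \<open>
  A leaf first makes the weight of its spine vertex \<open>j\<close> tie with, at most, the weight of the next
  vertex towards the peak, and the unit then climbs.
\<close>

lemma leaf_climbs:
  assumes "peaked a x b W" "b \<le> n" "a \<le> j" "j \<le> b" "0 < r j"
  shows "reaches n (W, r) (W(x := W x + 1), r(j := r j - 1))"
proof -
  let ?W = "W(j := W j + 1)" and ?r = "r(j := r j - 1)"
  have mv: "path_move n (W, r) (?W, ?r)"
    using assms peaked_pos[of a x b W j] by (intro absorb) auto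
  have up: "W i < W (Suc i)" if "a \<le> i" "i < x" for i
    using assms(1) that unfolding peaked_def by blast
  have down: "W i < W (i - 1)" if "x < i" "i \<le> b" for i
  proof -
    obtain i' where "i = Suc i'" using \<open>x < i\<close> by (cases i) auto
    then show ?thesis using assms(1) that unfolding peaked_def by auto
  qed
  have "reaches n (?W, ?r) (W(x := W x + 1), ?r)"
  proof -
    consider "j = x" | "j < x" | "x < j" by linarith
    then show ?thesis
    proof cases
      case 2
      have "reaches n (?W, ?r) (?W(j := ?W j - 1, x := ?W x + 1), ?r)"
      proof (rule climb_right)
        show "?W j \<le> ?W (Suc j)" using up[of j] 2 assms by simp
        show "?W i < ?W (Suc i)" if "j < i" "i < x" for i using up[of i] that assms by simp
        show "x \<le> n" using assms by (simp add: peaked_def)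
      qed (use 2 in auto)
      moreover have "?W(j := ?W j - 1, x := ?W x + 1) = W(x := W x + 1)"
        using 2 by (auto simp: fun_eq_iff)
      ultimately show ?thesis by (simp only:)
    next
      case 3
      have "reaches n (?W, ?r) (?W(j := ?W j - 1, x := ?W x + 1), ?r)"
      proof (rule climb_left)
        show "?W j \<le> ?W (j - 1)" using down[of j] 3 assms by auto
        show "?W i < ?W (i - 1)" if "x < i" "i < j" for i using down[of i] that assms by auto
        show "j \<le> n" using assms by simp
      qed (use 3 in auto)
      moreover have "?W(j := ?W j - 1, x := ?W x + 1) = W(x := W x + 1)"
        using 3 by (auto simp: fun_eq_iff)
      ultimately show ?thesis by (simp only:)
    qed auto
  qed
  with mv show ?thesis by (rule converse_rtranclp_into_rtranclp)
qed

text \<open>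
  Pending leaves climb to the peak first; then the outermost vertex sends its units there one by one.
  This lowers only the foot of the slope, so the weights stay strictly increasing towards the peak.
\<close>

lemma peaked_drains:
  assumes "peaked a x b W" "b \<le> n" "\<And>j. j \<le> n \<Longrightarrow> j < a \<or> b < j \<Longrightarrow> W j = 0 \<and> r j = 0"
  shows "\<exists>W' r'. reaches n (W, r) (W', r') \<and> (\<forall>j \<le> n. r' j = 0 \<and> (j \<noteq> x \<longrightarrow> W' j = 0))"
  using assms
proof (induction "(\<Sum>j \<le> n. r j) + (\<Sum>j \<in> {..n} - {x}. W j)" arbitrary: a b W r rule: less_induct)
  case less
  note peak = less.prems(1) and outside = less.prems(3)
  have ax: "a \<le> x" "x \<le> b" "b \<le> n" using peak less.prems(2) by (auto simp: peaked_def)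
  let ?mu = "\<lambda>W r. (\<Sum>j \<le> n. r j) + (\<Sum>j \<in> {..n} - {x}. W j)"
  have IH: ?case
    if "reaches n (W, r) (V, s)" "?mu V s < ?mu W r" "peaked a' x b' V" "b' \<le> n"
      "\<And>j. j \<le> n \<Longrightarrow> j < a' \<or> b' < j \<Longrightarrow> V j = 0 \<and> s j = 0" for V s a' b'
    using less.hyps[OF that(2-5)] that(1) by (meson rtranclp_trans)
  have dec: "(\<Sum>j \<in> A. (f(i := f i - 1)) j) < (\<Sum>j \<in> A. f j)"
    if "i \<in> A" "finite A" "0 < f i" for A and f :: "nat \<Rightarrow> nat" and i
    using that by (intro sum_strict_mono_ex1) auto
  consider j where "a \<le> j" "j \<le> b" "0 < r j" | "a < x" "\<forall>j. a \<le> j \<and> j \<le> b \<longrightarrow> r j = 0"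
    | "x < b" "\<forall>j. a \<le> j \<and> j \<le> b \<longrightarrow> r j = 0" | "a = x" "x = b" "\<forall>j. a \<le> j \<and> j \<le> b \<longrightarrow> r j = 0"
    using ax by (metis gr0I le_neq_implies_less)
  then show ?case
  proof cases
    case (1 j)
    show ?thesis
    proof (rule IH)
      show "reaches n (W, r) (W(x := W x + 1), r(j := r j - 1))"
        using 1 by (intro leaf_climbs[OF peak less.prems(2)])
      show "?mu (W(x := W x + 1)) (r(j := r j - 1)) < ?mu W r"
        using dec[of j "{..n}" r] 1 ax by simp
      show "peaked a x b (W(x := W x + 1))"
        using peak unfolding peaked_def by (auto simp: less_Suc_eq)
      show "(W(x := W x + 1)) i = 0 \<and> (r(j := r j - 1)) i = 0" if "i \<le> n" "i < a \<or> b < i" for i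
        using outside[OF that] that ax by auto
    qed (rule less.prems(2))
  next
    case 2
    let ?V = "W(a := W a - 1, x := W x + 1)"
    let ?a = "if W a = 1 then Suc a else a"
    have up: "W i < W (Suc i)" if "a \<le> i" "i < x" for i
      using peak that unfolding peaked_def by blast
    show ?thesis
    proof (rule IH)
      show "reaches n (W, r) (?V, r)"
      proof (rule climb_right)
        show "W a \<le> W (Suc a)" using up[of a] 2 by simp
        show "W i < W (Suc i)" if "a < i" "i < x" for i using up[of i] that by simp
      qed (use 2 ax peak in \<open>auto simp: peaked_def\<close>)
      have "(\<Sum>j \<in> {..n} - {x}. ?V j) = (\<Sum>j \<in> {..n} - {x}. (W(a := W a - 1)) j)"
        by (rule sum.cong) auto
      also have "\<dots> < (\<Sum>j \<in> {..n} - {x}. W j)"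
        using 2 ax peak by (intro dec) (auto simp: peaked_def)
      finally show "?mu ?V r < ?mu W r" by simp
      have "0 < W (Suc a)" using up[of a] 2 by simp
      then show "peaked ?a x b ?V"
        using peak 2 ax unfolding peaked_def by (auto simp: less_Suc_eq)
      show "?V i = 0 \<and> r i = 0" if "i \<le> n" "i < ?a \<or> b < i" for i
        using outside[of i] that ax 2 by (auto split: if_splits simp: less_Suc_eq)
    qed (rule less.prems(2))
  next
    case 3
    let ?V = "W(b := W b - 1, x := W x + 1)"
    let ?b = "if W b = 1 then b - 1 else b"
    have down: "W i < W (i - 1)" if "x < i" "i \<le> b" for i
    proof -
      obtain i' where "i = Suc i'" using \<open>x < i\<close> by (cases i) auto
      then show ?thesis using peak that unfolding peaked_def by auto
    qed
    show ?thesis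
    proof (rule IH)
      show "reaches n (W, r) (?V, r)"
      proof (rule climb_left)
        show "W b \<le> W (b - 1)" using down[of b] 3 by simp
        show "W i < W (i - 1)" if "x < i" "i < b" for i using down[of i] that by simp
      qed (use 3 ax peak in \<open>auto simp: peaked_def\<close>)
      have "(\<Sum>j \<in> {..n} - {x}. ?V j) = (\<Sum>j \<in> {..n} - {x}. (W(b := W b - 1)) j)"
        by (rule sum.cong) auto
      also have "\<dots> < (\<Sum>j \<in> {..n} - {x}. W j)"
        using 3 ax peak by (intro dec) (auto simp: peaked_def)
      finally show "?mu ?V r < ?mu W r" by simp
      show "peaked a x ?b ?V"
        unfolding peaked_def
      proof (intro conjI allI impI)
        have "0 < W (b - 1)" "0 < W b" using down[of b] 3 peak by (auto simp: peaked_def)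
        then show "0 < ?V ?b" using 3 by auto
        show "?V j < ?V (Suc j)" if "a \<le> j \<and> j < x" for j
          using peak that 3 unfolding peaked_def by (auto simp: less_Suc_eq)
        show "?V (Suc j) < ?V j" if "x \<le> j \<and> j < ?b" for j
        proof -
          have "j < b" using that by (auto split: if_splits)
          then have "W (Suc j) < W j" using peak that unfolding peaked_def by blast
          then show ?thesis using that \<open>j < b\<close> by auto
        qed
      qed (use 3 ax peak in \<open>auto simp: peaked_def\<close>)
      show "?V i = 0 \<and> r i = 0" if "i \<le> n" "i < a \<or> ?b < i" for i
      proof (cases "i = b")
        case True
        then show ?thesis using that ax 3 by (auto split: if_splits)
      next
        case False
        then have "i < a \<or> b < i" using that by (auto split: if_splits)
        then show ?thesis using outside[of i] that ax 3 by auto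
      qed
    qed (use less.prems(2) in auto)
  next
    case 4
    then have "\<forall>j \<le> n. r j = 0 \<and> (j \<noteq> x \<longrightarrow> W j = 0)"
      using outside by (metis linorder_neqE_nat order_refl)
    then show ?thesis by blast
  qed
qed

lemma path_gathers:
  assumes "0 < n" "0 < d 0" and d: "\<And>l u. 1 \<le> l \<Longrightarrow> l \<le> u \<Longrightarrow> u < n \<Longrightarrow> ell (u + 1 - l) \<le> (\<Sum>x = l..u. d x)"
  shows "\<exists>x W r. x \<le> n \<and> reaches n (\<lambda>_. 1, d) (W, r) \<and> (\<forall>j \<le> n. r j = 0 \<and> (j \<noteq> x \<longrightarrow> W j = 0))"
proof -
  obtain M where M: "serves n d M" and opt: "\<And>M'. serves n d M' \<Longrightarrow> cost n M \<le> cost n M'"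
    using serving_exists[OF d] ex_has_least_nat[of "serves n d" _ "cost n"] by blast
  define W where "W = level (cells n)"
  define r where "r = unused d M (cells n)"
  define c where "c = n div 2"
  have reach: "reaches n (\<lambda>_. 1, d) (W, r)"
    unfolding W_def r_def using pyramid_reachable[OF M opt] .
  have W: "W j = Suc (min j (n - j))" for j unfolding W_def by (rule level_cells)
  have unreached: "{e \<in> cells n. M e = 0} = {}"
    using M by (fastforce simp: serves_def cells_def)
  have r0: "0 < r 0" using \<open>0 < d 0\<close> unfolding r_def unused_def unreached by simp
  \<comment> \<open>for odd \<open>n\<close> the two middle weights are equal; one leaf of the end vertex \<open>0\<close> is used to make \<open>c\<close> the only peak\<close>
  have half: "peaked 0 c c W" unfolding peaked_def W c_def by auto
  have "reaches n (W, r) (W(c := W c + 1), r(0 := r 0 - 1))"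
    using leaf_climbs[where j = 0 and r = r and n = n, OF half] r0 by (simp add: c_def)
  with reach have reach': "reaches n (\<lambda>_. 1, d) (W(c := W c + 1), r(0 := r 0 - 1))"
    by (rule rtranclp_trans)
  have "peaked 0 c n (W(c := W c + 1))" unfolding peaked_def W c_def using \<open>0 < n\<close> by auto
  from peaked_drains[OF this, of n "r(0 := r 0 - 1)"] obtain W' r' where
    "reaches n (W(c := W c + 1), r(0 := r 0 - 1)) (W', r')"
    "\<forall>j \<le> n. r' j = 0 \<and> (j \<noteq> c \<longrightarrow> W' j = 0)" by auto
  moreover have "c \<le> n" by (simp add: c_def)
  ultimately show ?thesis using reach' by (meson rtranclp_trans)
qed

section \<open>The structure of a caterpillar\<close>

lemma (in nomulti_digraph) out_degree_eq_card: "out_degree G v = card {u. v \<rightarrow>\<^bsub>G\<^esub> u}"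
proof -
  have "bij_betw (head G) (out_arcs G v) {u. v \<rightarrow>\<^bsub>G\<^esub> u}"
    unfolding bij_betw_def
  proof
    show "inj_on (head G) (out_arcs G v)"
      by (rule inj_onI) (auto intro!: no_multi_arcs simp: arc_to_ends_def)
    show "head G ` out_arcs G v = {u. v \<rightarrow>\<^bsub>G\<^esub> u}"
      by (auto simp: arcs_ends_conv)
  qed
  then show ?thesis unfolding out_degree_def by (rule bij_betw_same_card)
qed

lemma dominates_induced:
  "u \<rightarrow>\<^bsub>G \<restriction> S\<^esub> v \<longleftrightarrow> u \<rightarrow>\<^bsub>G\<^esub> v \<and> u \<in> S \<and> v \<in> S"
  by (auto simp: arcs_ends_conv induce_subgraph_def image_iff)

locale caterpillar_with_spine =
  fixes T :: "('a, 'b) pre_digraph" and vs :: "'a list" and n :: nat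
  assumes caterpillar: "caterpillar T" and spine: "spine T vs"
    and length_vs: "length vs = Suc n" and n_pos: "0 < n"
begin

definition leaves :: "nat \<Rightarrow> 'a set" where
  "leaves j = {u. vs ! j \<rightarrow>\<^bsub>T\<^esub> u \<and> is_leaf T u}"

lemma graph: "graph T" and connected: "connected T"
  using caterpillar by (auto simp: caterpillar_def undirected_tree_def)

sublocale graph T by (rule graph)

lemma sym: "u \<rightarrow>\<^bsub>T\<^esub> v \<Longrightarrow> v \<rightarrow>\<^bsub>T\<^esub> u"
  using sym_arcs by (auto simp: symmetric_def dest: symD)

lemma set_vs: "set vs = non_leaves T" and distinct_vs: "distinct vs"
  using spine by (auto simp: spine_def path_graph_def)

lemma spine_inj: "i \<le> n \<Longrightarrow> j \<le> n \<Longrightarrow> vs ! i = vs ! j \<longleftrightarrow> i = j"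
  using distinct_vs length_vs by (simp add: nth_eq_iff_index_eq)

lemma spine_vertex: "j \<le> n \<Longrightarrow> vs ! j \<in> verts T \<and> \<not> is_leaf T (vs ! j)"
  using nth_mem[of j vs] length_vs by (auto simp: set_vs non_leaves_def)

lemma spine_index: "v \<in> verts T \<Longrightarrow> \<not> is_leaf T v \<Longrightarrow> \<exists>j \<le> n. v = vs ! j"
proof -
  assume "v \<in> verts T" "\<not> is_leaf T v"
  then have "v \<in> set vs" by (simp add: set_vs non_leaves_def)
  then show ?thesis by (metis in_set_conv_nth length_vs less_Suc_eq_le)
qed

lemma spine_arc:
  assumes "i \<le> n" "j \<le> n"
  shows "vs ! i \<rightarrow>\<^bsub>T\<^esub> vs ! j \<longleftrightarrow> j = Suc i \<or> i = Suc j"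
proof -
  have adj: "u \<rightarrow>\<^bsub>T \<restriction> non_leaves T\<^esub> v \<longleftrightarrow>
      (\<exists>m. Suc m < length vs \<and> {u, v} = {vs ! m, vs ! Suc m})" for u v
    using spine unfolding spine_def path_graph_def by blast
  have "vs ! i \<in> non_leaves T" "vs ! j \<in> non_leaves T"
    using assms length_vs by (simp_all flip: set_vs)
  then have "vs ! i \<rightarrow>\<^bsub>T\<^esub> vs ! j \<longleftrightarrow> vs ! i \<rightarrow>\<^bsub>T \<restriction> non_leaves T\<^esub> vs ! j"
    by (simp add: dominates_induced)
  also have "\<dots> \<longleftrightarrow> (\<exists>m. Suc m \<le> n \<and> {vs ! i, vs ! j} = {vs ! m, vs ! Suc m})"
    unfolding adj length_vs by (simp only: Suc_less_eq Suc_le_eq)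
  also have "\<dots> \<longleftrightarrow> (\<exists>m. Suc m \<le> n \<and> (i = m \<and> j = Suc m \<or> i = Suc m \<and> j = m))"
    using assms by (auto simp: doubleton_eq_iff spine_inj)
  also have "\<dots> \<longleftrightarrow> j = Suc i \<or> i = Suc j"
    using assms by auto
  finally show ?thesis .
qed

lemma leaf_neighbour: "is_leaf T u \<Longrightarrow> \<exists>v. u \<rightarrow>\<^bsub>T\<^esub> v"
  and leaf_neighbour_unique: "is_leaf T u \<Longrightarrow> u \<rightarrow>\<^bsub>T\<^esub> v \<Longrightarrow> u \<rightarrow>\<^bsub>T\<^esub> w \<Longrightarrow> v = w"
proof -
  assume "is_leaf T u"
  then obtain x where x: "{w. u \<rightarrow>\<^bsub>T\<^esub> w} = {x}"
    by (auto simp: is_leaf_def out_degree_eq_card card_1_singleton_iff)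
  then show "\<exists>v. u \<rightarrow>\<^bsub>T\<^esub> v" by blast
  show "v = w" if "u \<rightarrow>\<^bsub>T\<^esub> v" "u \<rightarrow>\<^bsub>T\<^esub> w"
  proof -
    have "v \<in> {w. u \<rightarrow>\<^bsub>T\<^esub> w}" "w \<in> {w. u \<rightarrow>\<^bsub>T\<^esub> w}" using that by simp_all
    then show ?thesis unfolding x by simp
  qed
qed

text \<open>
  Two adjacent leaves would form a connected component that contains no spine vertex.
\<close>

lemma leaf_hangs_on_spine: assumes "is_leaf T u" shows "\<exists>j \<le> n. u \<in> leaves j"
proof -
  obtain v where uv: "u \<rightarrow>\<^bsub>T\<^esub> v" using leaf_neighbour assms by blast
  have "\<not> is_leaf T v"
  proof
    assume "is_leaf T v"
    have "u \<rightarrow>\<^sup>*\<^bsub>T\<^esub> vs ! 0"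
      using symmetric_connected_imp_strongly_connected[OF sym_arcs connected] assms spine_vertex[of 0]
      by (auto simp: strongly_connected_def is_leaf_def)
    then have "vs ! 0 \<in> {u, v}"
    proof (induction rule: reachable_induct)
      case (step x y)
      then show ?case
        using leaf_neighbour_unique[OF assms uv] leaf_neighbour_unique[OF \<open>is_leaf T v\<close> sym[OF uv]]
        by auto
    qed simp
    then show False using assms \<open>is_leaf T v\<close> spine_vertex[of 0] by auto
  qed
  then obtain j where "j \<le> n" "v = vs ! j" using spine_index[of v] adj_in_verts(2)[OF uv] by blast
  then show ?thesis using sym[OF uv] assms by (auto simp: leaves_def)
qed

lemma leaves_disjoint: "u \<in> leaves i \<Longrightarrow> u \<in> leaves j \<Longrightarrow> i \<le> n \<Longrightarrow> j \<le> n \<Longrightarrow> i = j"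
  unfolding leaves_def mem_Collect_eq by (metis leaf_neighbour_unique sym spine_inj)

lemma spine_not_leaf: "j \<le> n \<Longrightarrow> vs ! j \<notin> leaves i"
  using spine_vertex by (auto simp: leaves_def)

lemma leaves_verts: "leaves j \<subseteq> verts T"
  by (auto simp: leaves_def is_leaf_def)

lemma finite_leaves: "finite (leaves j)"
  using leaves_verts finite_verts by (rule finite_subset)

lemma leaf_degree_eq: "leaf_degree T (vs ! j) = card (leaves j)"
  by (simp add: leaf_degree_def leaves_def)

lemma arc_cases:
  assumes "u \<rightarrow>\<^bsub>T\<^esub> v"
  obtains (spine) i j where "i \<le> n" "j \<le> n" "j = Suc i \<or> i = Suc j" "u = vs ! i" "v = vs ! j"
    | (inward) j where "j \<le> n" "u \<in> leaves j" "v = vs ! j"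
    | (outward) j where "j \<le> n" "u = vs ! j" "v \<in> leaves j"
proof -
  have hang: "\<exists>j \<le> n. x \<in> leaves j \<and> y = vs ! j" if xy: "x \<rightarrow>\<^bsub>T\<^esub> y" and "is_leaf T x" for x y
  proof -
    obtain j where "j \<le> n" "x \<in> leaves j" using leaf_hangs_on_spine \<open>is_leaf T x\<close> by blast
    moreover have "x \<rightarrow>\<^bsub>T\<^esub> vs ! j" using \<open>x \<in> leaves j\<close> by (auto simp: leaves_def intro: sym)
    ultimately show ?thesis using leaf_neighbour_unique[OF \<open>is_leaf T x\<close> xy] by blast
  qed
  consider "is_leaf T u" | "is_leaf T v" | "\<not> is_leaf T u" "\<not> is_leaf T v" by blast
  then show ?thesis
  proof cases
    case 1
    then show ?thesis using hang[OF assms] inward by blast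
  next
    case 2
    then show ?thesis using hang[OF sym[OF assms]] outward by blast
  next
    case 3
    then obtain i j where "i \<le> n" "j \<le> n" "u = vs ! i" "v = vs ! j"
      using spine_index adj_in_verts[OF assms] by blast
    then show ?thesis using spine_arc[of i j] assms spine by blast
  qed
qed

text \<open>
  An end of the spine has a single neighbour on the spine, so without adjacent leaves it would be a
  leaf itself.
\<close>

lemma end_leaves: assumes "j = 0 \<or> j = n" shows "leaves j \<noteq> {}"
proof
  assume none: "leaves j = {}"
  have jn: "j \<le> n" using assms by auto
  define i where "i = (if j = 0 then 1 else n - 1)"
  have i: "i \<le> n" "i = Suc j \<or> j = Suc i" using assms n_pos by (auto simp: i_def)
  have uniq: "i' = i" if "i' \<le> n" "i' = Suc j \<or> j = Suc i'" for i'
    using that assms n_pos by (auto simp: i_def)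
  have "{u. vs ! j \<rightarrow>\<^bsub>T\<^esub> u} = {vs ! i}"
  proof (intro set_eqI iffI)
    fix u assume "u \<in> {u. vs ! j \<rightarrow>\<^bsub>T\<^esub> u}"
    then have "vs ! j \<rightarrow>\<^bsub>T\<^esub> u" by simp
    then show "u \<in> {vs ! i}"
    proof (cases rule: arc_cases)
      case (spine a b)
      then have "a = j" using jn spine_inj by simp
      with spine uniq[of b] show ?thesis by auto
    next
      case (inward a)
      then show ?thesis using jn spine_not_leaf by blast
    next
      case (outward a)
      then have "a = j" using jn spine_inj by simp
      with outward none show ?thesis by simp
    qed
  next
    fix u assume "u \<in> {vs ! i}"
    then show "u \<in> {u. vs ! j \<rightarrow>\<^bsub>T\<^esub> u}" using spine_arc[of j i] i jn by auto
  qed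
  then have "is_leaf T (vs ! j)"
    using spine_vertex[OF jn] by (simp add: is_leaf_def out_degree_eq_card)
  then show False using spine_vertex[OF jn] by simp
qed

definition block :: "nat \<Rightarrow> 'a set" where
  "block j = insert (vs ! j) (leaves j)"

lemma verts_blocks: "verts T = (\<Union>j \<le> n. block j)"
proof
  show "verts T \<subseteq> (\<Union>j \<le> n. block j)"
    using leaf_hangs_on_spine spine_index by (fastforce simp: block_def)
  show "(\<Union>j \<le> n. block j) \<subseteq> verts T"
    using leaves_verts spine_vertex by (auto simp: block_def)
qed

lemma block_disjoint: "u \<in> block i \<Longrightarrow> u \<in> block j \<Longrightarrow> i \<le> n \<Longrightarrow> j \<le> n \<Longrightarrow> i = j"
  unfolding block_def using leaves_disjoint spine_not_leaf spine_inj by (metis insertE)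

lemma spine_in_block: "j \<le> n \<Longrightarrow> i \<le> n \<Longrightarrow> vs ! j \<in> block i \<longleftrightarrow> j = i"
  using block_disjoint[of "vs ! j" i j] by (auto simp: block_def)

section \<open>Acquisition on the caterpillar\<close>

abbreviation plays :: "('a \<Rightarrow> nat) \<Rightarrow> ('a \<Rightarrow> nat) \<Rightarrow> bool" where
  "plays \<equiv> (unit_acquisition_move T)\<^sup>*\<^sup>*"

definition positive :: "('a \<Rightarrow> nat) \<Rightarrow> 'a set" where
  "positive w = {v \<in> verts T. 0 < w v}"

lemma plays_positive:
  assumes "plays w w'" "positive w \<noteq> {}" shows "positive w' \<noteq> {}"
  using assms
proof (induction rule: rtranclp_induct)
  case (step w1 w2)
  then obtain u v where "u \<rightarrow>\<^bsub>T\<^esub> v" "w2 = w1(u := w1 u - 1, v := w1 v + 1)"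
    unfolding unit_acquisition_move_def by blast
  then have "v \<in> positive w2" using adj_in_verts by (auto simp: positive_def)
  then show ?case by blast
qed

text \<open>
  The number is never \<open>0\<close>, because the receiver of a move has positive weight afterwards.
\<close>

lemma number_eq_1_iff:
  "unit_acquisition_number T = 1 \<longleftrightarrow> (\<exists>w. plays (\<lambda>_. 1) w \<and> card (positive w) = 1)"
proof -
  let ?P = "\<lambda>m. \<exists>w. plays (\<lambda>_. 1) w \<and> m = card (positive w)"
  have num: "unit_acquisition_number T = (LEAST m. ?P m)"
    by (simp add: unit_acquisition_number_def positive_def)
  have "?P (card (positive (\<lambda>_. 1)))" by blast
  then have attained: "?P (LEAST m. ?P m)" by (rule LeastI)
  have "vs ! 0 \<in> positive (\<lambda>_. 1)" using spine_vertex[of 0] by (simp add: positive_def)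
  then have pos: "0 < m" if Pm: "?P m" for m
  proof -
    obtain w where w: "plays (\<lambda>_. 1) w" "m = card (positive w)" using Pm by blast
    then have "positive w \<noteq> {}" using plays_positive \<open>vs ! 0 \<in> _\<close> by blast
    moreover have "finite (positive w)" using finite_verts by (simp add: positive_def)
    ultimately show ?thesis using w(2) by (simp add: card_gt_0_iff)
  qed
  show ?thesis
  proof
    assume "unit_acquisition_number T = 1"
    then show "\<exists>w. plays (\<lambda>_. 1) w \<and> card (positive w) = 1" using attained num by metis
  next
    assume "\<exists>w. plays (\<lambda>_. 1) w \<and> card (positive w) = 1"
    then have "?P 1" by metis
    then have "(LEAST m. ?P m) \<le> 1" by (rule Least_le)
    then show "unit_acquisition_number T = 1" using pos[OF attained] num by linarith
  qed
qed

definition realizes :: "('a \<Rightarrow> nat) \<Rightarrow> (nat \<Rightarrow> nat) \<times> (nat \<Rightarrow> nat) \<Rightarrow> bool" where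
  "realizes w = (\<lambda>(W, r). \<forall>j \<le> n. w (vs ! j) = W j \<and> (\<forall>u \<in> leaves j. w u \<le> 1) \<and>
     card {u \<in> leaves j. w u = 1} = r j)"

lemma realize_path_move:
  assumes "path_move n S S'" "realizes w S"
  shows "\<exists>w'. unit_acquisition_move T w w' \<and> realizes w' S'"
  using assms(1)
proof cases
  case (absorb j r W)
  have w: "w (vs ! i) = W i" "\<And>u. u \<in> leaves i \<Longrightarrow> w u \<le> 1" "card {u \<in> leaves i. w u = 1} = r i"
    if "i \<le> n" for i using assms(2) that absorb by (auto simp: realizes_def)
  have "card {u \<in> leaves j. w u = 1} \<noteq> 0" using w(3)[of j] absorb by simp
  then have "{u \<in> leaves j. w u = 1} \<noteq> {}" by (metis card.empty)
  then obtain u where u: "u \<in> leaves j" "w u = 1" by blast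
  let ?w = "w(u := w u - 1, vs ! j := w (vs ! j) + 1)"
  have "u \<rightarrow>\<^bsub>T\<^esub> vs ! j" using u by (auto simp: leaves_def intro: sym)
  then have "unit_acquisition_move T w ?w"
    using u absorb w(1)[of j] unfolding unit_acquisition_move_def by force
  moreover have "realizes ?w S'"
    unfolding absorb realizes_def prod.case
  proof (intro allI impI conjI ballI)
    fix i assume i: "i \<le> n"
    have ne: "u \<noteq> vs ! i" using spine_not_leaf[OF i] u by blast
    then show "?w (vs ! i) = (W(j := W j + 1)) i"
      using w(1)[OF i] spine_inj[OF i, of j] absorb by auto
    have off: "v \<noteq> vs ! j" if "v \<in> leaves i" for v using that spine_not_leaf absorb by blast
    then show "?w v \<le> 1" if "v \<in> leaves i" for v using w(2)[OF i] that u by auto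
    show "card {v \<in> leaves i. ?w v = 1} = (r(j := r j - 1)) i"
    proof (cases "i = j")
      case True
      have "{v \<in> leaves i. ?w v = 1} = {v \<in> leaves j. w v = 1} - {u}" using True off u by auto
      then show ?thesis using True u w(3)[of j] absorb finite_leaves by simp
    next
      case False
      then have "u \<notin> leaves i" using leaves_disjoint u i absorb by blast
      then have "{v \<in> leaves i. ?w v = 1} = {v \<in> leaves i. w v = 1}" using off by auto
      then show ?thesis using False w(3)[OF i] by simp
    qed
  qed
  ultimately show ?thesis by blast
next
  case (shift a b W r)
  have w: "w (vs ! i) = W i" "\<And>u. u \<in> leaves i \<Longrightarrow> w u \<le> 1" "card {u \<in> leaves i. w u = 1} = r i"
    if "i \<le> n" for i using assms(2) that shift by (auto simp: realizes_def)
  let ?w = "w(vs ! a := w (vs ! a) - 1, vs ! b := w (vs ! b) + 1)"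
  have "vs ! a \<rightarrow>\<^bsub>T\<^esub> vs ! b" using spine_arc shift by simp
  then have "unit_acquisition_move T w ?w"
    using shift w(1)[of a] w(1)[of b] unfolding unit_acquisition_move_def by metis
  moreover have "realizes ?w S'"
    unfolding shift realizes_def prod.case
  proof (intro allI impI conjI ballI)
    fix i assume i: "i \<le> n"
    show "?w (vs ! i) = (W(a := W a - 1, b := W b + 1)) i"
      using w(1) i spine_inj[OF i] shift by auto
    have same: "?w v = w v" if "v \<in> leaves i" for v using that spine_not_leaf shift by auto
    then show "?w v \<le> 1" if "v \<in> leaves i" for v using w(2)[OF i] that by simp
    have "{v \<in> leaves i. ?w v = 1} = {v \<in> leaves i. w v = 1}"
      by (intro Collect_cong conj_cong refl) (simp only: same)
    then show "card {v \<in> leaves i. ?w v = 1} = r i" using w(3)[OF i] by simp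
  qed
  ultimately show ?thesis by blast
qed

lemma realize_path_moves:
  assumes "reaches n S S'" "realizes w S"
  shows "\<exists>w'. plays w w' \<and> realizes w' S'"
  using assms
proof (induction rule: rtranclp_induct)
  case (step S1 S2)
  then obtain w1 where "plays w w1" "realizes w1 S1" by blast
  with realize_path_move[OF step.hyps(2)] show ?case by (meson rtranclp.rtrancl_into_rtrancl)
qed blast

lemma gathers_if_windows_rich:
  assumes "\<And>l u. 1 \<le> l \<Longrightarrow> l \<le> u \<Longrightarrow> u < n \<Longrightarrow> ell (u + 1 - l) \<le> (\<Sum>x = l..u. card (leaves x))"
  shows "unit_acquisition_number T = 1"
proof -
  have "0 < card (leaves 0)" using end_leaves finite_leaves by (auto simp: card_gt_0_iff)
  from path_gathers[OF n_pos, of "\<lambda>j. card (leaves j)", OF this assms]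
  obtain x W r where x: "x \<le> n" and reach: "reaches n (\<lambda>_. 1, \<lambda>j. card (leaves j)) (W, r)"
    and fin: "\<forall>j \<le> n. r j = 0 \<and> (j \<noteq> x \<longrightarrow> W j = 0)" by blast
  have "realizes (\<lambda>_. 1) (\<lambda>_. 1, \<lambda>j. card (leaves j))" by (simp add: realizes_def)
  from realize_path_moves[OF reach this] obtain w where w: "plays (\<lambda>_. 1) w" and real: "realizes w (W, r)"
    by blast
  have "positive w \<subseteq> {vs ! x}"
  proof
    fix v assume "v \<in> positive w"
    then have v: "v \<in> verts T" "0 < w v" by (auto simp: positive_def)
    then obtain j where j: "j \<le> n" "v \<in> block j" using verts_blocks by blast
    have "v \<notin> leaves j"
    proof
      assume vl: "v \<in> leaves j"
      then have "w v = 1" using real v(2) j(1) by (force simp: realizes_def)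
      moreover have "card {u \<in> leaves j. w u = 1} = 0"
        using real fin j(1) unfolding realizes_def prod.case by metis
      moreover have "finite {u \<in> leaves j. w u = 1}" using finite_leaves by simp
      ultimately show False using vl unfolding card_0_eq[OF \<open>finite {u \<in> leaves j. w u = 1}\<close>] by blast
    qed
    then have "v = vs ! j" using j by (simp add: block_def)
    moreover from this have "j = x" using v(2) real fin j(1) by (auto simp: realizes_def)
    ultimately show "v \<in> {vs ! x}" by simp
  qed
  moreover have "positive w \<noteq> {}"
    using plays_positive[OF w] spine_vertex[of 0] by (auto simp: positive_def)
  ultimately have "positive w = {vs ! x}" by blast
  then show ?thesis using w number_eq_1_iff by auto
qed

end

section \<open>Poor windows block acquisition\<close>

lemma sum_transfer:
  fixes w :: "'c \<Rightarrow> nat"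
  assumes "finite R" "u \<noteq> v" "0 < w u"
  shows "(\<Sum>x \<in> R. (w(u := w u - 1, v := w v + 1)) x) + of_bool (u \<in> R)
    = (\<Sum>x \<in> R. w x) + of_bool (v \<in> R)"
  using assms(1)
proof (induction R rule: finite_induct)
  case (insert x R)
  then show ?case using assms(2,3) by (cases "x = u"; cases "x = v") auto
qed simp

lemma pyramid_slope: "pyramid i e (Suc t) \<le> pyramid i e t + 1" "pyramid i e t \<le> pyramid i e (Suc t) + 1"
  by (auto simp: pyramid_def)

context caterpillar_with_spine
begin

text \<open>
  A vertex of weight zero never takes part in a move again. If it separates two vertices of positive
  weight, then both sides of it keep positive weight forever.
\<close>

definition stuck :: "('a \<Rightarrow> nat) \<Rightarrow> bool" where
  "stuck w \<longleftrightarrow> (\<exists>z X. w z = 0 \<and> z \<notin> X \<and>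
     (\<forall>u v. u \<rightarrow>\<^bsub>T\<^esub> v \<longrightarrow> u \<noteq> z \<longrightarrow> v \<noteq> z \<longrightarrow> (u \<in> X \<longleftrightarrow> v \<in> X)) \<and>
     positive w \<inter> X \<noteq> {} \<and> positive w - X \<noteq> {})"

lemma stuck_move:
  assumes "stuck w" "unit_acquisition_move T w w'"
  shows "stuck w'"
proof -
  obtain z X where z: "w z = 0" "z \<notin> X"
    and closed: "\<And>u v. u \<rightarrow>\<^bsub>T\<^esub> v \<Longrightarrow> u \<noteq> z \<Longrightarrow> v \<noteq> z \<Longrightarrow> u \<in> X \<longleftrightarrow> v \<in> X"
    and two: "positive w \<inter> X \<noteq> {}" "positive w - X \<noteq> {}"
    using assms(1) unfolding stuck_def by blast
  obtain u v where uv: "u \<rightarrow>\<^bsub>T\<^esub> v" "0 < w u" "w u \<le> w v"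
    and w': "w' = w(u := w u - 1, v := w v + 1)"
    using assms(2) unfolding unit_acquisition_move_def by blast
  have ne: "u \<noteq> z" "v \<noteq> z" using uv z by auto
  have v: "v \<in> positive w'" using adj_in_verts[OF uv(1)] by (simp add: positive_def w')
  have same: "u \<in> X \<longleftrightarrow> v \<in> X" using closed[OF uv(1) ne] .
  have keep: "y \<in> positive w'" if "y \<in> positive w" "y \<noteq> u" for y
    using that by (auto simp: positive_def w')
  have "positive w' \<inter> X \<noteq> {}" "positive w' - X \<noteq> {}"
    using two v same keep by blast+
  then show ?thesis
    unfolding stuck_def using z closed ne by (intro exI[of _ z] exI[of _ X]) (auto simp: w')
qed

lemma stuck_not_single: "stuck w \<Longrightarrow> card (positive w) \<noteq> 1"
  unfolding stuck_def by (auto simp: card_1_singleton_iff)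

end

text \<open>
  The invariant of this section concerns the window \<open>{i..<e}\<close> of internal spine vertices. The
  position \<open>i - 1\<close> stands for everything to the left of the window, and \<open>e\<close> for everything to its right.
\<close>

locale spine_window = caterpillar_with_spine +
  fixes i e :: nat
  assumes window: "1 \<le> i" "i < e" "e \<le> n"
begin

abbreviation p :: "nat \<Rightarrow> nat" where
  "p \<equiv> pyramid i e"

definition region :: "nat \<Rightarrow> 'a set" where
  "region x = (if x < i then (\<Union>j<i. block j) else if x < e then {vs ! x} else (\<Union>j \<in> {e..n}. block j))"

text \<open>
  In the window, a frontier vertex has one unit more than is needed to fill the pyramid over it. At the
  positions \<open>i - 1\<close> and \<open>e\<close>, where \<open>p\<close> is \<open>0\<close>, the region still has two units, so that a border vertex
  that gives away its last unit strands weight behind a zero.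
\<close>

definition alive :: "('a \<Rightarrow> nat) \<Rightarrow> nat \<Rightarrow> bool" where
  "alive w x \<longleftrightarrow> p x + 2 \<le> (\<Sum>v \<in> region x. w v)"

text \<open>
  The number of unfilled cells at \<open>t\<close>, one more than the height of the pyramid if the vertex has weight
  \<open>0\<close>. Truncated subtraction ignores any weight above the pyramid.
\<close>

definition hole :: "('a \<Rightarrow> nat) \<Rightarrow> nat \<Rightarrow> nat" where
  "hole w t = p t + 1 - w (vs ! t)"

definition window_leaves :: "'a set" where
  "window_leaves = (\<Union>t \<in> {i..<e}. leaves t)"

text \<open>
  Between two frontiers there are more holes than the leaves of the window can fill. A frontier vertex
  with a unit to spare is heavier than a neighbour with a hole, so it cannot send weight there; the frontiers can
  meet only after all holes between them are closed, which never happens.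
\<close>

definition blocked :: "('a \<Rightarrow> nat) \<Rightarrow> bool" where
  "blocked w \<longleftrightarrow> (\<forall>j \<le> n. \<forall>u \<in> leaves j. w u \<le> 1) \<and>
     (\<exists>f g. i \<le> Suc f \<and> f < g \<and> g \<le> e \<and> alive w f \<and> alive w g \<and>
        (\<Sum>u \<in> window_leaves. w u) < (\<Sum>t = Suc f..<g. hole w t))"

lemma region_verts: "x \<le> n \<Longrightarrow> region x \<subseteq> verts T"
proof -
  assume "x \<le> n"
  moreover have "(\<Union>j<i. block j) \<subseteq> (\<Union>j \<le> n. block j)"
    by (rule UN_mono) (use window in auto)
  moreover have "(\<Union>j \<in> {e..n}. block j) \<subseteq> (\<Union>j \<le> n. block j)"
    by (rule UN_mono) auto
  ultimately show ?thesis using spine_vertex[of x] by (simp add: region_def verts_blocks)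
qed

lemma finite_region: "x \<le> n \<Longrightarrow> finite (region x)"
  using region_verts finite_verts finite_subset by blast

lemma spine_in_region: "x \<le> n \<Longrightarrow> vs ! x \<in> region x"
  using window by (auto simp: region_def block_def)

lemma region_iff:
  assumes "v \<in> block j" "j \<le> n"
  shows "v \<in> region x \<longleftrightarrow> (if x < i then j < i else if x < e then v = vs ! x else e \<le> j)"
proof -
  have same: "j' = j" if "v \<in> block j'" "j' \<le> n" for j'
    using block_disjoint[OF that(1) assms(1) that(2) assms(2)] .
  have "v \<in> (\<Union>j<i. block j) \<longleftrightarrow> j < i"
  proof
    assume "v \<in> (\<Union>j<i. block j)"
    then obtain j' where j': "j' < i" "v \<in> block j'" by blast
    then show "j < i" using same[OF j'(2)] window by simp
  qed (use assms in blast)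
  moreover have "v \<in> (\<Union>j \<in> {e..n}. block j) \<longleftrightarrow> e \<le> j"
  proof
    assume "v \<in> (\<Union>j \<in> {e..n}. block j)"
    then obtain j' where j': "e \<le> j'" "j' \<le> n" "v \<in> block j'" by auto
    then show "e \<le> j" using same[OF j'(3,2)] by simp
  qed (use assms in auto)
  ultimately show ?thesis by (simp add: region_def)
qed

lemma region_block:
  assumes "v \<in> region x" "v \<in> block j" "j \<le> n"
  shows "x < e \<Longrightarrow> i \<le> Suc x \<Longrightarrow> j \<le> x" "i \<le> x \<Longrightarrow> x \<le> e \<Longrightarrow> x \<le> j"
proof -
  have "j = x" if "v = vs ! x" "x < e"
    using that assms(2,3) spine_in_block[of x j] window by simp
  then show "x < e \<Longrightarrow> i \<le> Suc x \<Longrightarrow> j \<le> x" "i \<le> x \<Longrightarrow> x \<le> e \<Longrightarrow> x \<le> j"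
    using assms(1) unfolding region_iff[OF assms(2,3)] by (auto split: if_splits)
qed

lemma region_closed:
  assumes "u \<rightarrow>\<^bsub>T\<^esub> v" "x = i - 1 \<or> x = e" "u \<noteq> vs ! x" "v \<noteq> vs ! x"
  shows "u \<in> region x \<longleftrightarrow> v \<in> region x"
proof -
  have on_spine: "vs ! j \<in> region x \<longleftrightarrow> (if x < i then j < i else e \<le> j)" if "j \<le> n" for j
    using that assms(2) window region_iff[of "vs ! j" j x] by (auto simp: block_def)
  have leaf: "y \<in> region x \<longleftrightarrow> (if x < i then j < i else e \<le> j)" if "j \<le> n" "y \<in> leaves j" for j y
    using that assms(2) window region_iff[of y j x] by (auto simp: block_def)
  from assms(1) show ?thesis
  proof (cases rule: arc_cases)
    case (spine a b)
    then have "a \<noteq> x" "b \<noteq> x" using assms by auto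
    then show ?thesis using spine on_spine[of a] on_spine[of b] assms(2) window by auto
  next
    case (inward j)
    then show ?thesis using leaf on_spine by simp
  next
    case (outward j)
    then show ?thesis using leaf on_spine by simp
  qed
qed

lemma alive_witness:
  assumes "alive w x" "x \<le> n" shows "\<exists>v \<in> positive w. v \<in> region x"
proof (rule ccontr)
  assume "\<not> ?thesis"
  then have "w v = 0" if "v \<in> region x" for v
    using that region_verts[OF assms(2)] by (auto simp: positive_def)
  then have "(\<Sum>v \<in> region x. w v) = 0" by simp
  then show False using assms(1) by (simp add: alive_def)
qed

lemma blocked_not_single: assumes "blocked w" shows "card (positive w) \<noteq> 1"
proof
  assume "card (positive w) = 1"
  then obtain v where v: "positive w = {v}" by (auto simp: card_1_singleton_iff)
  then have "v \<in> verts T" by (auto simp: positive_def)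
  then obtain j where j: "j \<le> n" "v \<in> block j" using verts_blocks by blast
  obtain f g where fg: "i \<le> Suc f" "f < g" "g \<le> e" "alive w f" "alive w g"
    using assms unfolding blocked_def by blast
  then have "v \<in> region f" "v \<in> region g"
    using alive_witness[of w f] alive_witness[of w g] v window by auto
  then have "j \<le> f" "g \<le> j" using region_block j fg by auto
  then show False using fg by simp
qed

lemma alive_mono:
  assumes "alive w x" "(\<Sum>v \<in> region x. w v) \<le> (\<Sum>v \<in> region x. w' v)" shows "alive w' x"
  using assms by (simp add: alive_def)

text \<open>
  Only a side region can be alive while its border vertex is light. If the border vertex then gives
  away its last unit, the rest of the region is cut off.
\<close>

lemma heavy_frontier:
  assumes "alive w x" "i \<le> Suc x" "x \<le> e" "b = Suc x \<or> x = Suc b" "i \<le> Suc b" "b \<le> e"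
    and "0 < w (vs ! x)" and w': "w' = w(vs ! x := w (vs ! x) - 1, vs ! b := w (vs ! b) + 1)"
  shows "stuck w' \<or> p x + 2 \<le> w (vs ! x)"
proof (cases "i \<le> x \<and> x < e")
  case True
  then show ?thesis using assms(1) by (simp add: alive_def region_def)
next
  case False
  then have x: "x = i - 1 \<or> x = e" using assms by auto
  have xn: "x \<le> n" "b \<le> n" using assms window by auto
  have px: "p x = 0" using x window by (auto simp: pyramid_def)
  show ?thesis
  proof (cases "w (vs ! x) = 1")
    case False
    then show ?thesis using px assms(7) by simp
  next
    case True
    have "(\<Sum>v \<in> region x. w v) = 1 + (\<Sum>v \<in> region x - {vs ! x}. w v)"
      using True by (simp add: sum.remove[OF finite_region spine_in_region] xn)
    then have "0 < (\<Sum>v \<in> region x - {vs ! x}. w v)" using assms(1) by (simp add: alive_def)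
    then obtain y where y: "y \<in> region x - {vs ! x}" "0 < w y"
      by (metis gr0I sum.neutral less_irrefl)
    have bx: "vs ! b \<noteq> vs ! x" using spine_inj xn assms(4) by auto
    have b: "vs ! b \<notin> region x"
    proof
      assume "vs ! b \<in> region x"
      then have "x < e \<Longrightarrow> b \<le> x" "i \<le> x \<Longrightarrow> x \<le> b"
        using region_block[of "vs ! b" x b] xn assms(2,3) by (auto simp: block_def)
      then show False using x assms(4-6) window by auto
    qed
    have "stuck w'"
      unfolding stuck_def
    proof (intro exI conjI allI impI)
      show "w' (vs ! x) = 0" using True bx w' by auto
      show "vs ! x \<notin> region x - {vs ! x}" by simp
      show "(u \<in> region x - {vs ! x}) = (v \<in> region x - {vs ! x})"
        if "u \<rightarrow>\<^bsub>T\<^esub> v" "u \<noteq> vs ! x" "v \<noteq> vs ! x" for u v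
        using region_closed[OF that(1) x that(2,3)] that by simp
      show "positive w' \<inter> (region x - {vs ! x}) \<noteq> {}"
      proof -
        have "y \<noteq> vs ! x" "y \<noteq> vs ! b" "y \<in> verts T"
          using y(1) b region_verts[OF xn(1)] by auto
        then have "y \<in> positive w'" using y(2) w' by (simp add: positive_def)
        then show ?thesis using y(1) by blast
      qed
      show "positive w' - (region x - {vs ! x}) \<noteq> {}"
      proof -
        have "vs ! b \<in> positive w'" using w' spine_vertex[OF xn(2)] by (simp add: positive_def)
        then show ?thesis using b by blast
      qed
    qed
    then show ?thesis ..
  qed
qed

text \<open>
  A frontier \<open>x\<close> that sends a unit to a position \<open>b\<close> of the window, or to one of its two borders, hands
  its role over to \<open>b\<close>: the receiver was at least as heavy as \<open>x\<close>, and the pyramid is at most one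
  higher over \<open>b\<close>.
\<close>

lemma alive_spine_move:
  assumes x: "alive w x" "i \<le> Suc x" "x \<le> e"
    and ab: "a \<le> n" "b \<le> n" "b = Suc a \<or> a = Suc b"
    and wt: "0 < w (vs ! a)" "w (vs ! a) \<le> w (vs ! b)"
    and w': "w' = w(vs ! a := w (vs ! a) - 1, vs ! b := w (vs ! b) + 1)"
    and heavy: "a = x \<Longrightarrow> i \<le> Suc b \<Longrightarrow> b \<le> e \<Longrightarrow> p x + 2 \<le> w (vs ! x)"
  shows "alive w' (if a = x \<and> i \<le> Suc b \<and> b \<le> e then b else x)"
proof -
  have xn: "x \<le> n" using x window by simp
  have ne: "vs ! a \<noteq> vs ! b" using spine_inj[of a b] ab by auto
  show ?thesis
  proof (cases "a = x \<and> i \<le> Suc b \<and> b \<le> e")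
    case True
    then have "p x + 2 \<le> w (vs ! x)" using heavy by simp
    moreover have "p b \<le> p x + 1" using True ab pyramid_slope[of i e] by auto
    ultimately have "p b + 2 \<le> w' (vs ! b)" using True wt w' by simp
    also have "\<dots> \<le> (\<Sum>v \<in> region b. w' v)"
      using spine_in_region finite_region ab by (intro member_le_sum) auto
    finally show ?thesis using True by (simp add: alive_def)
  next
    case False
    have "vs ! b \<in> region x" if "vs ! a \<in> region x"
    proof (rule ccontr)
      assume nb: "vs ! b \<notin> region x"
      show False
      proof (cases "i \<le> x \<and> x < e")
        case True
        then have "a = x" using that spine_inj[of a x] ab xn by (auto simp: region_def)
        then show False using True False ab by auto
      next
        case out: False
        then have "x = i - 1 \<or> x = e" using x by auto
        moreover have "vs ! a \<rightarrow>\<^bsub>T\<^esub> vs ! b" using spine_arc ab by simp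
        ultimately have "vs ! a = vs ! x \<or> vs ! b = vs ! x"
          using region_closed[of "vs ! a" "vs ! b" x] that nb by auto
        then have "vs ! a = vs ! x" using nb spine_in_region xn by auto
        then have "a = x" using spine_inj ab xn by simp
        then have "b < i - 1 \<or> e < b" using False ab by auto
        moreover have "vs ! b \<in> block b" by (simp add: block_def)
        ultimately have "vs ! b \<in> region x" using \<open>a = x\<close> ab x out window by (auto simp: region_def)
        then show False using nb by simp
      qed
    qed
    then have "(\<Sum>v \<in> region x. w v) \<le> (\<Sum>v \<in> region x. w' v)"
      using sum_transfer[where w = w, OF finite_region[OF xn] ne wt(1)] w' by (cases "vs ! a \<in> region x") auto
    then have "alive w' x" using x(1) alive_mono by blast
    then show ?thesis using False by auto
  qed
qed

text \<open>
  Moves along the spine do not close holes: if the receiver \<open>b\<close> has a hole, then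
  \<open>w a \<le> w b \<le> p b \<le> p a + 1\<close>, so the sender acquires a hole.
\<close>

lemma holes_spine_move:
  assumes "finite I" "\<And>t. t \<in> I \<Longrightarrow> t \<le> n"
    and ab: "a \<le> n" "b \<le> n" "b = Suc a \<or> a = Suc b"
    and wt: "0 < w (vs ! a)" "w (vs ! a) \<le> w (vs ! b)"
    and w': "w' = w(vs ! a := w (vs ! a) - 1, vs ! b := w (vs ! b) + 1)"
    and "b \<in> I \<Longrightarrow> a \<in> I"
  shows "(\<Sum>t \<in> I. hole w t) \<le> (\<Sum>t \<in> I. hole w' t)"
proof (cases "b \<in> I")
  case False
  then show ?thesis
    using assms(2) spine_inj ab by (intro sum_mono) (auto simp: hole_def w')
next
  case True
  have ne: "a \<noteq> b" using ab by auto
  have split: "(\<Sum>t \<in> I. h t) = h a + (h b + (\<Sum>t \<in> I - {a} - {b}. h t))" for h :: "nat \<Rightarrow> nat"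
    using sum.remove[of I a h] sum.remove[of "I - {a}" b h] True assms ne by auto
  have "(\<Sum>t \<in> I - {a} - {b}. hole w t) = (\<Sum>t \<in> I - {a} - {b}. hole w' t)"
    using assms(2) spine_inj ab by (intro sum.cong) (auto simp: hole_def w')
  moreover have "hole w a + hole w b \<le> hole w' a + hole w' b"
  proof -
    have "p b \<le> p a + 1" using ab pyramid_slope[of i e] by auto
    moreover have "vs ! a \<noteq> vs ! b" using spine_inj ab ne by simp
    ultimately show ?thesis using wt by (auto simp: hole_def w')
  qed
  ultimately show ?thesis unfolding split by simp
qed

lemma finite_window_leaves: "finite window_leaves"
  by (simp add: window_leaves_def finite_leaves)

lemma spine_not_window_leaf: "j \<le> n \<Longrightarrow> vs ! j \<notin> window_leaves"
  using spine_not_leaf by (auto simp: window_leaves_def)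

lemma blocked_spine_move:
  assumes "blocked w" and ab: "a \<le> n" "b \<le> n" "b = Suc a \<or> a = Suc b"
    and wt: "0 < w (vs ! a)" "w (vs ! a) \<le> w (vs ! b)"
    and w': "w' = w(vs ! a := w (vs ! a) - 1, vs ! b := w (vs ! b) + 1)"
    and free: "\<not> stuck w'"
  shows "blocked w'"
proof -
  obtain f g where fg: "i \<le> Suc f" "f < g" "g \<le> e" "alive w f" "alive w g"
    and holes: "(\<Sum>u \<in> window_leaves. w u) < (\<Sum>t = Suc f..<g. hole w t)"
    and light: "\<forall>j \<le> n. \<forall>u \<in> leaves j. w u \<le> 1"
    using assms(1) unfolding blocked_def by blast
  have "{Suc f..<g} \<noteq> {}" using holes by (metis not_less_zero sum.empty)
  then have gap: "Suc f < g" by simp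
  have gn: "g \<le> n" using fg window by simp
  define moved where "moved x = (if a = x \<and> i \<le> Suc b \<and> b \<le> e then b else x)" for x
  have heavy: "p x + 2 \<le> w (vs ! x)"
    if "alive w x" "i \<le> Suc x" "x \<le> e" "a = x" "i \<le> Suc b" "b \<le> e" for x
    using heavy_frontier[of w x b w'] that ab wt w' free by auto
  have alive': "alive w' (moved f)" "alive w' (moved g)"
    unfolding moved_def using fg ab wt w' heavy
    by (intro alive_spine_move[where a = a and b = b and w = w]; simp)+
  \<comment> \<open>the receiver of a frontier has no hole, so that moving the frontier inward loses no holes\<close>
  have full: "hole w b = 0" if "a = x" "alive w x" "i \<le> Suc x" "x \<le> e" "i \<le> Suc b" "b \<le> e" for x
  proof -
    have "p b \<le> p a + 1" using ab pyramid_slope[of i e] by auto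
    then show ?thesis using heavy[OF that(2-4,1,5,6)] that(1) wt by (simp add: hole_def)
  qed
  have off: "hole w' t = hole w t" if "t \<noteq> a" "t \<noteq> b" "t \<le> n" for t
    using that ab spine_inj w' by (simp add: hole_def)
  have "moved f < moved g \<and> i \<le> Suc (moved f) \<and> moved g \<le> e \<and>
      (\<Sum>t = Suc f..<g. hole w t) \<le> (\<Sum>t = Suc (moved f)..<moved g. hole w' t)"
  proof -
    have still: "moved x = x" if "a \<noteq> x" for x using that by (simp add: moved_def)
    have step: "moved x = x \<or> moved x = b" for x by (simp add: moved_def)
    consider (stay) "moved f = f" "moved g = g"
      | (left_up) "a = f" "b = Suc f" "moved f = b" "moved g = g"
      | (left_down) "a = f" "Suc b = f" "moved f = b" "moved g = g"
      | (right_up) "a = g" "b = Suc g" "moved g = b" "moved f = f"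
      | (right_down) "a = g" "Suc b = g" "moved g = b" "moved f = f"
      using ab(3) fg(2) still[of f] still[of g] step[of f] step[of g]
      by (cases "a = f"; cases "a = g") auto
    then show ?thesis
    proof cases
      case stay
      have "a \<in> {Suc f..<g}" if "b \<in> {Suc f..<g}"
      proof -
        have "a \<noteq> f" "a \<noteq> g" using stay that fg ab unfolding moved_def by (auto split: if_splits)
        then show ?thesis using that ab by auto
      qed
      then have "(\<Sum>t = Suc f..<g. hole w t) \<le> (\<Sum>t = Suc f..<g. hole w' t)"
        using gn by (intro holes_spine_move[OF _ _ ab wt w']) auto
      then show ?thesis using stay fg by simp
    next
      case left_up
      have "hole w b = 0" using full[of f] left_up fg gap by simp
      then have "(\<Sum>t = Suc f..<g. hole w t) = (\<Sum>t = Suc b..<g. hole w t)"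
        using left_up gap by (simp add: sum.atLeast_Suc_lessThan)
      also have "\<dots> = (\<Sum>t = Suc b..<g. hole w' t)"
        using left_up gn off by (intro sum.cong) auto
      finally show ?thesis using left_up fg gap by simp
    next
      case left_down
      have "(\<Sum>t = Suc f..<g. hole w t) = (\<Sum>t = Suc f..<g. hole w' t)"
        using left_down gn off by (intro sum.cong) auto
      also have "\<dots> \<le> (\<Sum>t = Suc b..<g. hole w' t)"
        using left_down by (intro sum_mono2) auto
      finally have "(\<Sum>t = Suc f..<g. hole w t) \<le> (\<Sum>t = Suc b..<g. hole w' t)" .
      moreover have "i \<le> Suc b"
        using left_down unfolding moved_def by (auto split: if_splits)
      ultimately show ?thesis using left_down fg by simp
    next
      case right_up
      have "(\<Sum>t = Suc f..<g. hole w t) = (\<Sum>t = Suc f..<g. hole w' t)"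
        using right_up gn off by (intro sum.cong) auto
      also have "\<dots> \<le> (\<Sum>t = Suc f..<b. hole w' t)"
        using right_up by (intro sum_mono2) auto
      finally have "(\<Sum>t = Suc f..<g. hole w t) \<le> (\<Sum>t = Suc f..<b. hole w' t)" .
      moreover have "b \<le> e"
        using right_up unfolding moved_def by (auto split: if_splits)
      ultimately show ?thesis using right_up fg by simp
    next
      case right_down
      have "hole w b = 0" using full[of g] right_down fg gap by simp
      moreover have "{Suc f..<g} = insert b {Suc f..<b}" using right_down gap by auto
      ultimately have "(\<Sum>t = Suc f..<g. hole w t) = (\<Sum>t = Suc f..<b. hole w t)" by simp
      also have "\<dots> = (\<Sum>t = Suc f..<b. hole w' t)"
        using right_down gn off by (intro sum.cong) auto
      finally show ?thesis using right_down fg gap by simp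
    qed
  qed
  moreover have "(\<Sum>u \<in> window_leaves. w' u) = (\<Sum>u \<in> window_leaves. w u)"
    using spine_not_window_leaf ab by (intro sum.cong) (auto simp: w')
  moreover have "\<forall>j \<le> n. \<forall>u \<in> leaves j. w' u \<le> 1"
    using light spine_not_leaf ab by (auto simp: w')
  ultimately show "blocked w'"
    unfolding blocked_def using holes alive' by (metis order_less_le_trans)
qed

text \<open>
  A leaf of the window closes at most one hole, and its unit no longer counts as pending.
\<close>

lemma blocked_inward_move:
  assumes "blocked w" and j: "j \<le> n" "u \<in> leaves j" and wt: "0 < w u"
    and w': "w' = w(u := w u - 1, vs ! j := w (vs ! j) + 1)"
  shows "blocked w'"
proof -
  obtain f g where fg: "i \<le> Suc f" "f < g" "g \<le> e" "alive w f" "alive w g"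
    and holes: "(\<Sum>u \<in> window_leaves. w u) < (\<Sum>t = Suc f..<g. hole w t)"
    and light: "\<forall>j \<le> n. \<forall>u \<in> leaves j. w u \<le> 1"
    using assms(1) unfolding blocked_def by blast
  have gn: "g \<le> n" using fg window by simp
  have ne: "u \<noteq> vs ! j" using spine_not_leaf j by blast
  have off: "u \<noteq> vs ! t" if "t \<le> n" for t using spine_not_leaf that j by blast
  have alive': "alive w' x" if "alive w x" "x \<le> n" for x
  proof -
    have "vs ! j \<in> region x" if "u \<in> region x"
      using that region_iff[of u j x] region_iff[of "vs ! j" j x] j off \<open>x \<le> n\<close>
      by (auto simp: block_def split: if_splits)
    then show ?thesis
      using sum_transfer[where w = w, OF finite_region[OF \<open>x \<le> n\<close>] ne wt] that(1) w'
      by (cases "u \<in> region x") (auto simp: alive_def)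
  qed
  have hole': "hole w t \<le> hole w' t + of_bool (t = j)" if "t \<le> n" for t
    using that spine_inj[OF that j(1)] off by (auto simp: hole_def w')
  have "(\<Sum>t = Suc f..<g. hole w t) \<le> (\<Sum>t = Suc f..<g. hole w' t + of_bool (t = j))"
    using hole' gn by (intro sum_mono) auto
  also have "\<dots> = (\<Sum>t = Suc f..<g. hole w' t) + of_bool (j \<in> {Suc f..<g})"
    by (simp add: sum.distrib of_bool_def sum.delta)
  finally have "(\<Sum>t = Suc f..<g. hole w t) \<le> (\<Sum>t = Suc f..<g. hole w' t) + of_bool (j \<in> {Suc f..<g})" .
  moreover have "(\<Sum>u \<in> window_leaves. w' u) + of_bool (u \<in> window_leaves) = (\<Sum>u \<in> window_leaves. w u)"
    using sum_transfer[where w = w, OF finite_window_leaves ne wt] spine_not_window_leaf[OF j(1)] w' by simp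
  moreover have "u \<in> window_leaves" if "j \<in> {Suc f..<g}"
    using that fg j unfolding window_leaves_def by auto
  ultimately have "(\<Sum>u \<in> window_leaves. w' u) < (\<Sum>t = Suc f..<g. hole w' t)"
    using holes by (cases "j \<in> {Suc f..<g}") auto
  moreover have "\<forall>j \<le> n. \<forall>u \<in> leaves j. w' u \<le> 1"
    using light spine_not_leaf j by (auto simp: w' le_diff_conv)
  ultimately show ?thesis
    unfolding blocked_def using fg gn alive' by (meson less_imp_le order_trans)
qed

text \<open>
  Since leaves have weight at most one, a spine vertex that sends a unit to a leaf has weight one. It
  drops to zero and isolates the leaf, while at least one of the two alive regions lies elsewhere.
\<close>

lemma blocked_outward_move:
  assumes "blocked w" and j: "j \<le> n" "u \<in> leaves j" and wt: "0 < w (vs ! j)" "w (vs ! j) \<le> w u"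
    and w': "w' = w(vs ! j := w (vs ! j) - 1, u := w u + 1)"
  shows "stuck w'"
proof -
  obtain f g where fg: "i \<le> Suc f" "f < g" "g \<le> e" "alive w f" "alive w g"
    and light: "\<forall>j \<le> n. \<forall>u \<in> leaves j. w u \<le> 1"
    using assms(1) unfolding blocked_def by blast
  have one: "w (vs ! j) = 1" using light j wt by force
  have ne: "u \<noteq> vs ! j" using spine_not_leaf j by blast
  have "\<exists>y \<in> positive w. y \<notin> block j"
  proof (rule ccontr)
    assume "\<not> ?thesis"
    then obtain y z where "y \<in> region f" "y \<in> block j" "z \<in> region g" "z \<in> block j"
      using alive_witness[OF fg(4)] alive_witness[OF fg(5)] fg window by (meson le_trans less_imp_le)
    then have "j \<le> f" "g \<le> j" using region_block j(1) fg by auto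
    then show False using fg by simp
  qed
  then obtain y where y: "y \<in> positive w" "y \<notin> block j" by blast
  then have y_ne: "y \<noteq> u" "y \<noteq> vs ! j" using j by (auto simp: block_def)
  have leaf: "is_leaf T u" and arc: "u \<rightarrow>\<^bsub>T\<^esub> vs ! j" using j by (auto simp: leaves_def intro: sym)
  show ?thesis
    unfolding stuck_def
  proof (intro exI conjI allI impI)
    show "w' (vs ! j) = 0" using one ne w' by simp
    show "vs ! j \<notin> {u}" using ne by simp
    show "a \<in> {u} \<longleftrightarrow> b \<in> {u}" if "a \<rightarrow>\<^bsub>T\<^esub> b" "a \<noteq> vs ! j" "b \<noteq> vs ! j" for a b
      using leaf_neighbour_unique[OF leaf arc] sym[OF that(1)] that by auto
    have "u \<in> positive w'" using leaf w' by (auto simp: positive_def is_leaf_def)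
    then show "positive w' \<inter> {u} \<noteq> {}" by blast
    have "y \<in> positive w'" using y y_ne w' by (auto simp: positive_def)
    then show "positive w' - {u} \<noteq> {}" using y_ne by blast
  qed
qed

lemma blocked_move:
  assumes "blocked w" "unit_acquisition_move T w w'"
  shows "stuck w' \<or> blocked w'"
proof -
  obtain u v where uv: "u \<rightarrow>\<^bsub>T\<^esub> v" "0 < w u" "w u \<le> w v"
    and w': "w' = w(u := w u - 1, v := w v + 1)"
    using assms(2) unfolding unit_acquisition_move_def by blast
  from uv(1) show ?thesis
  proof (cases rule: arc_cases)
    case (spine a b)
    then show ?thesis using blocked_spine_move[OF assms(1), of a b w'] uv w' by auto
  next
    case (inward j)
    then show ?thesis using blocked_inward_move[OF assms(1), of j u w'] uv w' by simp
  next
    case (outward j)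
    then show ?thesis using blocked_outward_move[OF assms(1), of j v w'] uv w' by simp
  qed
qed

lemma two_in_region:
  assumes "x = i - 1 \<or> x = e" shows "2 \<le> card (region x)"
proof -
  have xn: "x \<le> n" using assms window by auto
  have "\<exists>y \<in> region x. y \<noteq> vs ! x"
  proof (cases "x = 0 \<or> x = n")
    case True
    then obtain u where u: "u \<in> leaves x" using end_leaves by blast
    then have "u \<in> region x" using region_iff[of u x x] assms window xn by (auto simp: block_def)
    moreover have "u \<noteq> vs ! x" using u spine_not_leaf xn by blast
    ultimately show ?thesis by blast
  next
    case False
    define y where "y = (if x < i then x - 1 else Suc x)"
    have yn: "y \<le> n" "y \<noteq> x" using False xn by (auto simp: y_def)
    have "vs ! y \<in> region x"
      using region_iff[of "vs ! y" y x] yn assms window by (auto simp: block_def y_def)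
    moreover have "vs ! y \<noteq> vs ! x" using spine_inj yn xn by simp
    ultimately show ?thesis by blast
  qed
  then obtain y where "y \<in> region x" "y \<noteq> vs ! x" by blast
  then have "card {y, vs ! x} \<le> card (region x)"
    using spine_in_region finite_region xn by (intro card_mono) auto
  then show ?thesis using \<open>y \<noteq> vs ! x\<close> by simp
qed

lemma blocked_initially:
  assumes "(\<Sum>t = i..<e. card (leaves t)) < ell (e - i)"
  shows "blocked (\<lambda>_. 1)"
proof -
  have "card window_leaves = (\<Sum>t = i..<e. card (leaves t))"
    unfolding window_leaves_def
    using leaves_disjoint window by (intro card_UN_disjoint) (auto simp: finite_leaves)
  moreover have "(\<Sum>t = i..<e. hole (\<lambda>_. 1) t) = ell (e - i)"
    using sum_pyramid[of i "e - i"] window by (simp add: hole_def)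
  moreover have "alive (\<lambda>_. 1) (i - 1)" "alive (\<lambda>_. 1) e"
    using two_in_region[of "i - 1"] two_in_region[of e] window by (auto simp: alive_def pyramid_def)
  ultimately show ?thesis
    unfolding blocked_def using assms window
    by (intro conjI exI[of _ "i - 1"] exI[of _ e]) auto
qed

lemma windows_rich_if_gathers:
  assumes "unit_acquisition_number T = 1"
  shows "ell (e - i) \<le> (\<Sum>t = i..<e. card (leaves t))"
proof (rule ccontr)
  assume "\<not> ?thesis"
  then have start: "blocked (\<lambda>_. 1)" by (intro blocked_initially) simp
  obtain w where w: "plays (\<lambda>_. 1) w" "card (positive w) = 1" using assms number_eq_1_iff by blast
  from w(1) have "stuck w \<or> blocked w"
  proof (induction rule: rtranclp_induct)
    case base
    then show ?case using start by simp
  next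
    case (step w1 w2)
    then show ?case using stuck_move blocked_move by blast
  qed
  then show False using w(2) stuck_not_single blocked_not_single by blast
qed

end

section \<open>Characterization of caterpillars with acquisition number one\<close>

theorem theorem4p3:
  fixes T :: "('a, 'b) pre_digraph" and k :: nat and vs :: "'a list"
  assumes "caterpillar T"
    and "spine T vs"
    and "length vs = k + 2"
  shows "unit_acquisition_number T = 1 \<longleftrightarrow>
    (\<forall>s i. 1 \<le> s \<and> s \<le> k \<and> 1 \<le> i \<and> i + s - 1 \<le> k \<longrightarrow>
       (\<Sum>v \<in> {vs ! j | j. i \<le> j \<and> j \<le> i + s - 1}. leaf_degree T v) \<ge> ell s)"
proof -
  interpret caterpillar_with_spine T vs "k + 1"
    using assms by unfold_locales auto
  have window_sum: "(\<Sum>v \<in> {vs ! j | j. i \<le> j \<and> j \<le> i + s - 1}. leaf_degree T v)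
      = (\<Sum>t = i..<i + s. card (leaves t))"
    if "1 \<le> s" "i + s - 1 \<le> k" for i s
  proof -
    have "{vs ! j | j. i \<le> j \<and> j \<le> i + s - 1} = (!) vs ` {j. i \<le> j \<and> j \<le> i + s - 1}" by blast
    also have "{j. i \<le> j \<and> j \<le> i + s - 1} = {i..<i + s}" using that(1) by auto
    finally have "{vs ! j | j. i \<le> j \<and> j \<le> i + s - 1} = (!) vs ` {i..<i + s}" .
    moreover have "inj_on ((!) vs) {i..<i + s}"
      using that spine_inj by (intro inj_onI) auto
    ultimately show ?thesis by (simp add: sum.reindex leaf_degree_eq)
  qed
  show ?thesis
  proof (intro iffI allI impI)
    fix s i assume one: "unit_acquisition_number T = 1"
      and si: "1 \<le> s \<and> s \<le> k \<and> 1 \<le> i \<and> i + s - 1 \<le> k"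
    then interpret spine_window T vs "k + 1" i "i + s" by unfold_locales auto
    show "ell s \<le> (\<Sum>v \<in> {vs ! j | j. i \<le> j \<and> j \<le> i + s - 1}. leaf_degree T v)"
      using windows_rich_if_gathers[OF one] window_sum si by simp
  next
    assume *: "\<forall>s i. 1 \<le> s \<and> s \<le> k \<and> 1 \<le> i \<and> i + s - 1 \<le> k \<longrightarrow>
       (\<Sum>v \<in> {vs ! j | j. i \<le> j \<and> j \<le> i + s - 1}. leaf_degree T v) \<ge> ell s"
    show "unit_acquisition_number T = 1"
    proof (rule gathers_if_windows_rich)
      fix l u :: nat assume lu: "1 \<le> l" "l \<le> u" "u < k + 1"
      then have bounds: "1 \<le> u + 1 - l" "u + 1 - l \<le> k" "l + (u + 1 - l) - 1 \<le> k" by auto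
      have "ell (u + 1 - l) \<le> (\<Sum>t = l..<l + (u + 1 - l). card (leaves t))"
        unfolding window_sum[OF bounds(1,3), symmetric] using * bounds lu(1) by blast
      also have "{l..<l + (u + 1 - l)} = {l..u}" using lu by auto
      finally show "ell (u + 1 - l) \<le> (\<Sum>x = l..u. card (leaves x))" .
    qed
  qed
qed

end
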